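(* Let $t\geq 4$ be an even integer and let $a,b,c\geq 1$ be integers with $a+b\geq t-1$. Put $v=a+b+c+1$ and let $L=\{1^a,2^b,t^c\}$, and suppose $t\leq \lfloor v/2\rfloor$. Then there exists a Hamiltonian path $H$ of $K_v$ with $\ell(H)=L$ if and only if the following condition holds: for every divisor $d$ of $v$, the number of elements of $L$ (counted with multiplicity) that are multiples of $d$ does not exceed $v-d$.
   Context: $K_v$ is the complete graph on the vertex set $\{0,1,\dots,v-1\}$. The length of an edge $[x,y]$ of $K_v$ is $\ell(x,y)=\min(|x-y|,\,v-|x-y|)$. For a subgraph $\Gamma$ of $K_v$, $\ell(\Gamma)$ is the multiset of lengths of all edges of $\Gamma$ (with multiplicity). The notation $\{1^{a},2^{b},t^{c}\}$ denotes the multiset consisting of $a$ copies of $1$, $b$ copies of $2$ and $c$ copies of $t$. (The paper phrases the claim as "$\mathrm{BHR}(\{1^a,2^b,t^c\})$ holds", where $\mathrm{BHR}(L)$, for a list $L$ of $v-1$ positive integers not exceeding $\lfloor v/2\rfloor$, is the assertion stated in the claim.) *)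

theory Defs
  imports Main "HOL-Library.Multiset"
begin

definition edge_len :: "nat \<Rightarrow> nat \<Rightarrow> nat \<Rightarrow> nat" where
  "edge_len v x y = min (if x \<le> y then y - x else x - y) (v - (if x \<le> y then y - x else x - y))"

definition ham_path :: "nat \<Rightarrow> nat list \<Rightarrow> bool" where
  "ham_path v P \<longleftrightarrow> distinct P \<and> set P = {0..<v}"

definition path_lengths :: "nat \<Rightarrow> nat list \<Rightarrow> nat multiset" where
  "path_lengths v P = mset (map (\<lambda>(x,y). edge_len v x y) (zip P (tl P)))"

definition L_list :: "nat \<Rightarrow> nat \<Rightarrow> nat \<Rightarrow> nat \<Rightarrow> nat multiset" where
  "L_list a b t c = replicate_mset a 1 + replicate_mset b 2 + replicate_mset c t"

end

theory Submission
  imports Defs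
begin

text \<open>
  For a divisor \<open>d > 2\<close> of \<open>v\<close> only the \<open>c\<close> copies of \<open>t\<close> can be multiples of \<open>d\<close>, and if they are, then
  \<open>d \<le> t \<le> a + b + 1 = v - c\<close>. So the divisor condition always holds, and a path has to be found for all
  admissible \<open>a, b, c\<close>.

  Write \<open>c + t = q * t + r\<close> with \<open>1 \<le> r \<le> t\<close>. The vertices below \<open>c + t\<close> form \<open>t\<close> columns, the residue
  classes modulo \<open>t\<close>. Traversing all columns, alternately upwards and downwards, uses exactly \<open>c\<close> edges
  of length \<open>t\<close>, and it remains to order the columns so that the links between consecutive ones have
  length 1 or 2. Links alternate between the bottom, where the columns are ordered \<open>0, \<dots>, t - 1\<close>,
  and the top, where they are ordered \<open>r, \<dots>, t - 1, 0, \<dots>, r - 1\<close>; so a link between \<open>r - 1\<close> and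
  \<open>r\<close> has to be at the bottom, and one between \<open>t - 1\<close> and \<open>0\<close> at the top. Which orders work depends on
  \<open>a\<close> and on \<open>r\<close> and \<open>t\<close> modulo 4.

  The remaining \<open>a + b + 1 - t\<close> vertices are absorbed in one of three ways: edges of length 2 are
  inserted at an edge joining the two largest (or smallest) vertices; edges of length 1 are appended
  at an end of the path that is an extreme vertex; or two strands of steps of length 2 cross the gap
  between the last and the first vertex of the cycle. If \<open>a = 1\<close> and \<open>v\<close> is even, the path is instead
  obtained from two realizations of lists \<open>{1\<^sup>x, (t/2)\<^sup>y}\<close> in the cycle of length \<open>v / 2\<close>, one on each
  parity class, which can be rotated so that they meet in the single edge of length 1.
\<close>

section \<open>Edge lengths and insertion of vertices\<close>

fun steps :: "(nat \<Rightarrow> nat \<Rightarrow> nat) \<Rightarrow> nat list \<Rightarrow> nat multiset" where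
  "steps f (x # y # l) = add_mset (f x y) (steps f (y # l))"
| "steps f l = {#}"

text \<open>The distance |x - y|: with truncated subtraction at least one summand is zero.\<close>

definition gap :: "nat \<Rightarrow> nat \<Rightarrow> nat" where
  "gap x y = (x - y) + (y - x)"

lemma gap_simps: "x \<le> y \<Longrightarrow> gap x y = y - x" "y \<le> x \<Longrightarrow> gap x y = x - y"
  by (simp_all add: gap_def)

lemma gap_add_right [simp]: "gap (x + k) (y + k) = gap x y"
  by (simp add: gap_def)

lemma gap_mirror: "x \<le> k \<Longrightarrow> y \<le> k \<Longrightarrow> gap (k - x) (k - y) = gap x y"
  by (auto simp: gap_def)

lemma gap_commute: "gap x y = gap y x"
  by (simp add: gap_def)

lemma edge_len_gap: "edge_len v x y = min (gap x y) (v - gap x y)"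
  by (simp add: edge_len_def gap_def)

lemma edge_len_eq_gap: "gap x y \<le> v div 2 \<Longrightarrow> edge_len v x y = gap x y"
  unfolding edge_len_gap by linarith

lemma edge_len_commute: "edge_len v x y = edge_len v y x"
  by (simp add: edge_len_gap gap_commute)

lemma path_lengths_steps: "path_lengths v P = steps (edge_len v) P"
  by (induction P rule: induct_list012) (simp_all add: path_lengths_def)

lemma steps_append:
  assumes "xs \<noteq> []" "ys \<noteq> []"
  shows "steps f (xs @ ys) = steps f xs + add_mset (f (last xs) (hd ys)) (steps f ys)"
  using assms
proof (induction xs rule: induct_list012)
  case (2 x)
  then show ?case by (cases ys) auto
qed auto

lemma steps_Cons: "ys \<noteq> [] \<Longrightarrow> steps f (x # ys) = add_mset (f x (hd ys)) (steps f ys)"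
  by (cases ys) auto

lemma steps_snoc: "xs \<noteq> [] \<Longrightarrow> steps f (xs @ [y]) = add_mset (f (last xs) y) (steps f xs)"
  by (simp add: steps_append)

lemma steps_rev:
  assumes "\<And>x y. f x y = f y x"
  shows "steps f (rev xs) = steps f xs"
proof (induction xs)
  case (Cons x xs)
  show ?case
    by (cases "xs = []") (auto simp: Cons steps_snoc steps_Cons last_rev assms[of x])
qed simp

lemmas steps_gap_rev [simp] = steps_rev[of gap, OF gap_commute]

lemma steps_map: "steps f (map g xs) = steps (\<lambda>x y. f (g x) (g y)) xs"
  by (induction f xs rule: steps.induct) auto

lemma steps_cong_on:
  assumes "\<And>x y. x \<in> set xs \<Longrightarrow> y \<in> set xs \<Longrightarrow> f x y = g x y"
  shows "steps f xs = steps g xs"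
  using assms by (induction f xs rule: steps.induct) auto

lemma steps_gap_shift [simp]: "steps gap (map (\<lambda>x. x + k) xs) = steps gap xs"
  by (simp add: steps_map)

lemma steps_gap_mirror: "set xs \<subseteq> {..k} \<Longrightarrow> steps gap (map (\<lambda>x. k - x) xs) = steps gap xs"
  unfolding steps_map by (rule steps_cong_on) (auto simp: gap_mirror subset_iff)

lemma steps_gap_upt: "steps gap [a..<b] = replicate_mset (b - a - 1) 1"
proof (induction b)
  case (Suc b)
  show ?case
  proof (cases "a < b")
    case True
    then have "Suc b - a - 1 = Suc (b - a - 1)" "steps gap [a..<Suc b] = add_mset (gap (b - 1) b) (steps gap [a..<b])"
      by (simp_all add: steps_snoc)
    then show ?thesis using Suc True by (simp add: gap_simps)
  next
    case False
    then show ?thesis by (cases "a = b") auto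
  qed
qed simp

section \<open>Runs in steps of 2, and hooks\<close>

definition by_twos :: "nat \<Rightarrow> nat \<Rightarrow> nat list" where
  "by_twos a n = map (\<lambda>i. a + 2 * i) [0..<n]"

lemma length_by_twos [simp]: "length (by_twos a n) = n"
  by (simp add: by_twos_def)

lemma by_twos_eq_Nil [simp]: "by_twos a n = [] \<longleftrightarrow> n = 0"
  by (simp add: by_twos_def)

lemma by_twos_0 [simp]: "by_twos a 0 = []"
  by simp

lemma hd_by_twos [simp]: "0 < n \<Longrightarrow> hd (by_twos a n) = a"
  by (simp add: by_twos_def hd_map)

lemma last_by_twos [simp]: "0 < n \<Longrightarrow> last (by_twos a n) = a + 2 * (n - 1)"
  by (simp add: by_twos_def last_map)

lemma by_twos_Suc: "by_twos a (Suc n) = by_twos a n @ [a + 2 * n]"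
  by (simp add: by_twos_def)

lemma in_set_by_twos: "x \<in> set (by_twos a n) \<longleftrightarrow> a \<le> x \<and> x < a + 2 * n \<and> (even x \<longleftrightarrow> even a)"
proof
  assume "a \<le> x \<and> x < a + 2 * n \<and> (even x \<longleftrightarrow> even a)"
  then have "x = a + 2 * ((x - a) div 2)" "(x - a) div 2 < n" by auto
  moreover from this(2) have "(x - a) div 2 \<in> set [0..<n]" by simp
  ultimately show "x \<in> set (by_twos a n)" unfolding by_twos_def set_map by blast
qed (auto simp: by_twos_def)

text \<open>For equal parities the weaker bound \<open>a \<le> x + 1\<close> is equivalent to
  \<open>a \<le> x\<close>; its negation is stronger, which helps arithmetic when a column order is
  shown to cover all columns.\<close>

lemma in_set_by_twos_iff: "x \<in> set (by_twos a n) \<longleftrightarrow> (even x \<longleftrightarrow> even a) \<and> a \<le> x + 1 \<and> x < a + 2 * n"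
  unfolding in_set_by_twos by presburger

lemma steps_by_twos:
  assumes "\<And>x. a \<le> x \<Longrightarrow> x + 2 < a + 2 * n \<Longrightarrow> f x (x + 2) = 2"
  shows "steps f (by_twos a n) = replicate_mset (n - 1) 2"
  using assms
proof (induction n)
  case (Suc n)
  show ?case
  proof (cases n)
    case (Suc m)
    have "f (a + 2 * m) (a + 2 * m + 2) = 2" using Suc by (intro Suc.prems) auto
    then show ?thesis using Suc.IH Suc.prems Suc by (simp add: by_twos_Suc[of a "Suc m"] steps_snoc)
  qed (simp add: by_twos_def)
qed (simp add: by_twos_def)

lemma steps_gap_by_twos [simp]: "steps gap (by_twos a n) = replicate_mset (n - 1) 2"
  by (rule steps_by_twos) (simp add: gap_simps)

text \<open>\<open>hook n\<close> is \<open>n - 1, n - 3, \<dots>, n - 4, n - 2\<close>: down in steps of 2, one step of 1, and up again.\<close>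

fun hook :: "nat \<Rightarrow> nat list" where
  "hook 0 = []"
| "hook (Suc n) = n # rev (hook n)"

text \<open>The mirror image of \<open>hook n\<close>: for \<open>2 \<le> n\<close> it runs 0, 2, 4,
  ..., turns by a step of 1 and comes back to 1.\<close>

definition hook_up :: "nat \<Rightarrow> nat list" where
  "hook_up n = map (\<lambda>x. n - 1 - x) (hook n)"

lemma length_hook [simp]: "length (hook n) = n"
  by (induction n) auto

lemma set_hook [simp]: "set (hook n) = {..<n}"
  by (induction n) (simp_all add: lessThan_Suc)

lemma hook_eq_Nil [simp]: "hook n = [] \<longleftrightarrow> n = 0"
  by (cases n) auto

lemma hd_hook [simp]: "0 < n \<Longrightarrow> hd (hook n) = n - 1"
  by (cases n) auto

lemma last_hook [simp]: "0 < n \<Longrightarrow> last (hook n) = n - 2"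
  by (cases n) (auto simp: last_rev)

lemma steps_gap_hook:
  assumes "2 \<le> n"
  shows "steps gap (hook n) = add_mset 1 (replicate_mset (n - 2) 2)"
  using assms
proof (induction n rule: nat_induct_at_least)
  case base
  show ?case by (simp add: numeral_2_eq_2 gap_simps)
next
  case (Suc n)
  have "steps gap (hook (Suc n)) = add_mset (gap n (hd (rev (hook n)))) (steps gap (rev (hook n)))"
    using Suc.hyps by (simp add: steps_Cons)
  moreover have "hd (rev (hook n)) = n - 2"
    using Suc.hyps by (simp add: hd_rev)
  moreover have "Suc n - 2 = Suc (n - 2)" "gap n (n - 2) = 2"
    using Suc.hyps by (simp_all add: gap_simps)
  ultimately show ?case using Suc.IH by simp
qed

lemma length_hook_up [simp]: "length (hook_up n) = n"
  by (simp add: hook_up_def)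

lemma set_hook_up [simp]: "set (hook_up n) = {..<n}"
proof -
  have "(\<lambda>x. n - 1 - x) ` {..<n} = {..<n}"
  proof (intro equalityI subsetI)
    fix x assume "x \<in> {..<n}"
    then have "x = n - 1 - (n - 1 - x)" "n - 1 - x \<in> {..<n}" by auto
    then show "x \<in> (\<lambda>x. n - 1 - x) ` {..<n}" by blast
  qed auto
  then show ?thesis by (simp add: hook_up_def)
qed

lemma hook_up_eq_Nil [simp]: "hook_up n = [] \<longleftrightarrow> n = 0"
  by (simp add: hook_up_def)

lemma hd_hook_up [simp]: "0 < n \<Longrightarrow> hd (hook_up n) = 0"
  by (simp add: hook_up_def hd_map)

lemma last_hook_up [simp]: "0 < n \<Longrightarrow> last (hook_up n) = n - 1 - (n - 2)"
  by (simp add: hook_up_def last_map)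

lemma steps_gap_hook_up:
  assumes "2 \<le> n"
  shows "steps gap (hook_up n) = add_mset 1 (replicate_mset (n - 2) 2)"
proof -
  have "set (hook n) \<subseteq> {..n - 1}" using assms by auto
  then show ?thesis unfolding hook_up_def by (simp add: steps_gap_mirror steps_gap_hook[OF assms])
qed

section \<open>Linear realizations and their growth\<close>

text \<open>Lengths are plain distances here, independent of \<open>v\<close>, so they survive when
  vertices are added.\<close>

definition linear :: "nat \<Rightarrow> nat list \<Rightarrow> nat multiset \<Rightarrow> bool" where
  "linear v P L \<longleftrightarrow> distinct P \<and> set P = {0..<v} \<and> steps gap P = L"

definition adjacent :: "nat list \<Rightarrow> nat \<Rightarrow> nat \<Rightarrow> bool" where
  "adjacent P x y \<longleftrightarrow> (\<exists>A B. P = A @ [x, y] @ B \<or> P = A @ [y, x] @ B)"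

lemma adjacentI: "P = A @ [x, y] @ B \<Longrightarrow> adjacent P x y"
  unfolding adjacent_def by blast

lemma adjacent_commute: "adjacent P x y \<longleftrightarrow> adjacent P y x"
  unfolding adjacent_def by blast

lemma adjacent_map: "adjacent P x y \<Longrightarrow> adjacent (map f P) (f x) (f y)"
proof -
  assume "adjacent P x y"
  then obtain A B where "P = A @ [x, y] @ B \<or> P = A @ [y, x] @ B" unfolding adjacent_def by blast
  then have "map f P = map f A @ [f x, f y] @ map f B \<or> map f P = map f A @ [f y, f x] @ map f B" by auto
  then show ?thesis unfolding adjacent_def by blast
qed

lemma linear_rev: "linear v P L \<Longrightarrow> linear v (rev P) L"
  by (simp add: linear_def)

lemma linear_mirror:
  assumes "linear v P L"
  shows "linear v (map (\<lambda>x. v - 1 - x) P) L"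
proof -
  have "inj_on (\<lambda>x. v - 1 - x) {0..<v}" by (auto simp: inj_on_def)
  moreover have "(\<lambda>x. v - 1 - x) ` {0..<v} = {0..<v}"
  proof (intro equalityI subsetI)
    fix x assume "x \<in> {0..<v}"
    then have "x = v - 1 - (v - 1 - x)" "v - 1 - x \<in> {0..<v}" by auto
    then show "x \<in> (\<lambda>x. v - 1 - x) ` {0..<v}" by blast
  qed auto
  moreover have "set P \<subseteq> {..v - 1}" using assms by (auto simp: linear_def)
  ultimately show ?thesis using assms steps_gap_mirror[of P "v - 1"] by (simp add: linear_def distinct_map)
qed

text \<open>The edge from \<open>v - 2\<close> to \<open>v - 1\<close> is replaced by
  \<open>v - 2, v, v - 1\<close>, with lengths 2 and 1. The two largest vertices are neighbours
  again, so the insertion can be repeated.\<close>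

lemma linear_insert:
  assumes "linear v P L" "adjacent P (v - 2) (v - 1)" "2 \<le> v"
  shows "\<exists>P'. linear (Suc v) P' (add_mset 2 L) \<and> adjacent P' (v - 1) v"
proof -
  have *: ?thesis if l: "linear v Q L" and Q: "Q = A @ [v - 2, v - 1] @ B" for Q A B
  proof -
    let ?P = "A @ [v - 2, v, v - 1] @ B"
    have "steps gap ?P = add_mset 2 (steps gap Q)"
      unfolding Q using \<open>2 \<le> v\<close>
      by (cases "A = []"; cases "B = []") (simp_all add: steps_append steps_Cons gap_simps)
    moreover have "set ?P = insert v (set Q)" unfolding Q by auto
    moreover have "v \<notin> set Q" using l by (simp add: linear_def)
    then have "distinct ?P" using l by (auto simp: linear_def Q)
    moreover have "insert v {0..<v} = {0..<Suc v}" by auto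
    ultimately have "linear (Suc v) ?P (add_mset 2 L)" using l by (simp add: linear_def)
    moreover have "adjacent ?P (v - 1) v" unfolding adjacent_def by (metis append_Cons append_Nil append_assoc)
    ultimately show ?thesis by blast
  qed
  from assms(2) obtain A B where "P = A @ [v - 2, v - 1] @ B \<or> P = A @ [v - 1, v - 2] @ B"
    unfolding adjacent_def by blast
  then show ?thesis
  proof
    assume "P = A @ [v - 1, v - 2] @ B"
    then have "rev P = rev B @ [v - 2, v - 1] @ rev A" by simp
    then show ?thesis using * linear_rev assms(1) by blast
  qed (use * assms(1) in blast)
qed

lemma linear_insert_many:
  assumes "linear v P L" "adjacent P (v - 2) (v - 1)" "2 \<le> v"
  shows "\<exists>P'. linear (v + e) P' (L + replicate_mset e 2)"
proof -
  have "\<exists>P'. linear (v + e) P' (L + replicate_mset e 2) \<and> adjacent P' (v + e - 2) (v + e - 1)"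
  proof (induction e)
    case (Suc e)
    then obtain P' where "linear (v + e) P' (L + replicate_mset e 2)" "adjacent P' (v + e - 2) (v + e - 1)"
      by blast
    from linear_insert[OF this] \<open>2 \<le> v\<close> show ?case by auto
  qed (use assms in auto)
  then show ?thesis by blast
qed

lemma linear_snoc:
  assumes "linear v P L" "P \<noteq> []" "last P = v - 1"
  shows "linear (Suc v) (P @ [v]) (add_mset 1 L)"
proof -
  have "v \<noteq> 0" using hd_in_set[OF assms(2)] assms(1) by (auto simp: linear_def)
  then show ?thesis using assms by (auto simp: linear_def steps_snoc gap_simps)
qed

text \<open>Mirroring moves the end 0 to \<open>v - 1\<close>, where vertices can be appended one by
  one. Since \<open>0 < k\<close>, the two largest vertices are neighbours afterwards, and edges of
  length 2 can be inserted there.\<close>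

lemma linear_extend:
  assumes "linear v P L" "P \<noteq> []" "hd P = 0" "0 < k"
  shows "\<exists>P'. linear (v + k + e) P' (L + replicate_mset k 1 + replicate_mset e 2)"
proof -
  let ?P = "rev (map (\<lambda>x. v - 1 - x) P)"
  have "\<exists>P'. linear (v + k) P' (L + replicate_mset k 1) \<and> P' \<noteq> [] \<and> last P' = v + k - 1
          \<and> (0 < k \<longrightarrow> adjacent P' (v + k - 2) (v + k - 1))" for k
  proof (induction k)
    case 0
    have "linear v ?P L" using assms(1) linear_mirror linear_rev by blast
    then show ?case using assms(2,3) by (intro exI[of _ ?P]) (auto simp: last_rev hd_map)
  next
    case (Suc k)
    then obtain P' where P': "linear (v + k) P' (L + replicate_mset k 1)" "P' \<noteq> []" "last P' = v + k - 1"
      by blast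
    then have "P' @ [v + k] = butlast P' @ [v + k - 1, v + k] @ []"
      by (metis append.right_neutral append_Cons append_Nil append_assoc append_butlast_last_id)
    then have "adjacent (P' @ [v + k]) (v + k - 1) (v + k)" by (rule adjacentI)
    then show ?case using linear_snoc[OF P'] by (intro exI[of _ "P' @ [v + k]"]) auto
  qed
  from this[of k] obtain P' where P': "linear (v + k) P' (L + replicate_mset k 1)"
      "adjacent P' (v + k - 2) (v + k - 1)"
    using \<open>0 < k\<close> by blast
  have "v \<noteq> 0" using hd_in_set[OF assms(2)] assms(1) by (auto simp: linear_def)
  then show ?thesis using linear_insert_many[OF P'] \<open>0 < k\<close> by auto
qed

definition realizable :: "nat \<Rightarrow> nat multiset \<Rightarrow> bool" where
  "realizable v L \<longleftrightarrow> (\<exists>P. ham_path v P \<and> path_lengths v P = L)"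

lemma steps_edge_len:
  assumes "\<And>x. x \<in># steps gap Q \<Longrightarrow> x \<le> v div 2"
  shows "steps (edge_len v) Q = steps gap Q"
  using assms by (induction gap Q rule: steps.induct) (auto simp: edge_len_eq_gap)

lemma linear_realizable:
  assumes "linear v P L" "\<And>x. x \<in># L \<Longrightarrow> x \<le> v div 2"
  shows "realizable v L"
  using assms steps_edge_len[of P v] by (auto simp: realizable_def ham_path_def linear_def path_lengths_steps)

section \<open>Columns\<close>

text \<open>The case \<open>q = 0\<close>, \<open>r = t\<close> is that of \<open>t\<close> columns with a single vertex each.\<close>

locale columns =
  fixes t q r :: nat
  assumes r_pos: "1 \<le> r" and r_le: "r \<le> t" and q_pos: "1 \<le> q \<or> r = t"
begin

definition v0 :: nat where "v0 = q * t + r"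

text \<open>The number of edges, not of vertices, of a column.\<close>

definition height :: "nat \<Rightarrow> nat" where "height j = (if j < r then q else q - 1)"

definition column :: "nat \<Rightarrow> nat list" where
  "column j = map (\<lambda>k. j + k * t) [0..<Suc (height j)]"

definition column_end :: "bool \<Rightarrow> nat \<Rightarrow> nat" where
  "column_end u j = (if u then j + height j * t else j)"

text \<open>The Boolean tells whether the first column is traversed upwards; its link to the next column is then at the top.\<close>

fun snake :: "bool \<Rightarrow> nat list \<Rightarrow> nat list" where
  "snake u [] = []"
| "snake u (j # js) = (if u then column j else rev (column j)) @ snake (\<not> u) js"

fun links :: "bool \<Rightarrow> nat list \<Rightarrow> nat multiset" where
  "links u (j # k # js) = add_mset (gap (column_end u j) (column_end u k)) (links (\<not> u) (k # js))"
| "links u js = {#}"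

lemma column_ne [simp]: "column j \<noteq> []"
  by (simp add: column_def)

lemma hd_column [simp]: "hd (column j) = column_end False j"
  by (simp add: column_def column_end_def hd_map del: upt_Suc)

lemma last_column [simp]: "last (column j) = column_end True j"
  by (simp add: column_def column_end_def)

lemma snake_eq_Nil [simp]: "snake u js = [] \<longleftrightarrow> js = []"
  by (cases js) auto

lemma snake_append: "snake u (xs @ ys) = snake u xs @ snake (u = even (length xs)) ys"
proof (induction xs arbitrary: u)
  case (Cons x xs)
  have "((\<not> u) = even (length xs)) = (u = odd (length xs))" by blast
  then show ?case using Cons by simp
qed (cases u; simp)

lemma hd_snake [simp]: "js \<noteq> [] \<Longrightarrow> hd (snake u js) = column_end (\<not> u) (hd js)"
  by (cases js) (auto simp: hd_rev)

lemma last_snake [simp]: "js \<noteq> [] \<Longrightarrow> last (snake u js) = column_end (u = odd (length js)) (last js)"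
proof (induction js arbitrary: u)
  case (Cons j js)
  have "((\<not> u) = odd (length js)) = (u = even (length js))" by blast
  then show ?case using Cons by (cases "js = []") (auto simp: last_rev)
qed simp

text \<open>Directions alternate, so the parity of \<open>length xs\<close> decides whether the
  joining link is at the top and in which direction \<open>ys\<close> is entered.\<close>

lemma links_append:
  assumes "xs \<noteq> []" "ys \<noteq> []"
  shows "links u (xs @ ys) = links u xs + add_mset (gap (column_end (u = odd (length xs)) (last xs)) (column_end (u = odd (length xs)) (hd ys)))
    (links (u = even (length xs)) ys)"
  using assms
proof (induction u xs rule: links.induct)
  case (1 u j k js)
  have e: "((\<not> u) = odd n) = (u = even n)" "((\<not> u) = even n) = (u = odd n)" for n :: nat by blast+
  show ?case using 1 e by auto
next
  case ("2_2" u v)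
  then show ?case by (cases ys) auto
qed auto

lemma steps_column: "steps gap (column j) = replicate_mset (height j) t"
proof -
  have "steps f [0..<Suc n] = replicate_mset n t" if "\<And>k. f k (Suc k) = t" for f n
  proof (induction n)
    case (Suc n)
    have "steps f ([0..<Suc n] @ [Suc n]) = add_mset (f n (Suc n)) (steps f [0..<Suc n])"
      by (subst steps_snoc) auto
    then show ?case using Suc that by simp
  qed simp
  then show ?thesis unfolding column_def steps_map by (simp add: gap_simps del: upt_Suc)
qed

lemma steps_snake: "steps gap (snake u js) = links u js + replicate_mset (\<Sum>j\<leftarrow>js. height j) t"
proof (induction js arbitrary: u)
  case (Cons j js)
  let ?c = "if u then column j else rev (column j)"
  have c: "?c \<noteq> []" "steps gap ?c = replicate_mset (height j) t" "last ?c = column_end u j"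
    by (auto simp: steps_column last_rev)
  show ?case
  proof (cases js)
    case Nil
    then show ?thesis using c by simp
  next
    case (Cons k ks)
    then have "steps gap (snake u (j # js)) = replicate_mset (height j) t + add_mset (gap (column_end u j) (column_end u k)) (steps gap (snake (\<not> u) js))"
      using c by (subst snake.simps(2), subst steps_append) (auto simp: hd_rev)
    moreover have "links u (j # js) = add_mset (gap (column_end u j) (column_end u k)) (links (\<not> u) js)"
      using Cons by simp
    ultimately show ?thesis using Cons.IH[of "\<not> u"] by (simp add: multiset_eq_iff del: snake.simps)
  qed
qed simp

lemma t_pos: "0 < t"
  using r_pos r_le by simp

text \<open>Since \<open>v0 = q * t + r\<close>, exactly the columns below \<open>r\<close> have a
  vertex in row \<open>q\<close>, counting rows from 0; the others stop in row
  \<open>q - 1\<close>.\<close>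

lemma set_column:
  assumes "j < t"
  shows "set (column j) = {x. x < v0 \<and> x mod t = j}"
proof (intro equalityI subsetI)
  fix x assume "x \<in> set (column j)"
  then obtain k where "k \<in> set [0..<Suc (height j)]" and k: "x = j + k * t"
    unfolding column_def set_map by blast
  then have k: "x = j + k * t" "k \<le> height j" by auto
  have "x < v0"
  proof (cases "j < r")
    case True
    then have "k * t \<le> q * t" using k by (intro mult_le_mono1) (simp add: height_def)
    with True have "j + k * t < r + q * t" by (rule add_less_le_mono)
    then show ?thesis using k by (simp add: v0_def add.commute)
  next
    case False
    then have "k \<le> q - 1" "1 \<le> q" using k q_pos \<open>j < t\<close> by (auto simp: height_def)
    then have "Suc k * t \<le> q * t" by (intro mult_le_mono1) simp
    then show ?thesis using k \<open>j < t\<close> r_pos by (simp add: v0_def)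
  qed
  then show "x \<in> {x. x < v0 \<and> x mod t = j}" using k \<open>j < t\<close> by simp
next
  fix x assume "x \<in> {x. x < v0 \<and> x mod t = j}"
  then have x: "x < v0" "x = j + (x div t) * t" by (auto simp: mult.commute)
  have "x div t \<le> height j"
  proof (rule ccontr)
    assume *: "\<not> x div t \<le> height j"
    then have "Suc (height j) * t \<le> x div t * t" by (intro mult_le_mono1) simp
    show False
    proof (cases "j < r")
      case True
      then have "q * t + t \<le> x div t * t" using \<open>Suc (height j) * t \<le> x div t * t\<close> by (simp add: height_def)
      then show False using x r_le unfolding v0_def by linarith
    next
      case False
      then have "Suc (height j) = q" using q_pos \<open>j < t\<close> by (auto simp: height_def)
      then have "q * t \<le> x div t * t" using \<open>Suc (height j) * t \<le> x div t * t\<close> by metis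
      then show False using x False unfolding v0_def by linarith
    qed
  qed
  then show "x \<in> set (column j)" using x(2) by (auto simp: column_def simp del: upt_Suc)
qed

lemma distinct_column: "distinct (column j)"
  using t_pos by (auto simp: column_def distinct_map inj_on_def simp del: upt_Suc)

lemma set_snake: "set js \<subseteq> {..<t} \<Longrightarrow> set (snake u js) = {x. x < v0 \<and> x mod t \<in> set js}"
  by (induction js arbitrary: u) (auto simp: set_column)

lemma distinct_snake: "distinct js \<Longrightarrow> set js \<subseteq> {..<t} \<Longrightarrow> distinct (snake u js)"
  by (induction js arbitrary: u) (auto simp: set_snake set_column distinct_column)

text \<open>By counting, a list of length \<open>t\<close> that covers \<open>t\<close> columns
  repeats none. For each explicit column order only coverage and length need checking.\<close>

lemma coverD:
  assumes "{..<t} \<subseteq> set js" "length js = t"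
  shows "set js = {..<t}" "distinct js"
proof -
  have "card (set js) \<le> card {..<t}" using card_length[of js] assms by simp
  then show "set js = {..<t}" using card_seteq[OF _ assms(1)] by simp
  then show "distinct js" using assms(2) by (simp add: card_distinct)
qed

text \<open>Each of the \<open>t\<close> columns has one edge fewer than vertices. For
  \<open>v0 = c + t\<close> this yields \<open>c\<close> edges of length \<open>t\<close>.\<close>

lemma sum_height: "(\<Sum>j\<leftarrow>js. height j) + t = v0" if "set js = {..<t}" "distinct js"
proof -
  have "(\<Sum>j\<leftarrow>js. height j) = (\<Sum>j<t. height j)" using that by (simp add: sum_list_distinct_conv_sum_set)
  also have "\<dots> = (\<Sum>j<r. height j) + (\<Sum>j\<in>{r..<t}. height j)"
    using r_le by (simp flip: sum.atLeastLessThan_concat[of 0 r t] add: lessThan_atLeast0)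
  also have "\<dots> = r * q + (t - r) * (q - 1)" by (simp add: height_def)
  finally have "(\<Sum>j\<leftarrow>js. height j) + t = r * q + ((t - r) * (q - 1) + (t - r)) + r"
    using r_le by simp
  also have "(t - r) * (q - 1) + (t - r) = (t - r) * q" using q_pos by (cases q) auto
  also have "r * q + (t - r) * q = t * q" using r_le by (simp flip: add_mult_distrib)
  finally show ?thesis by (simp add: v0_def mult.commute)
qed

lemma linear_snake:
  assumes "{..<t} \<subseteq> set js" "length js = t" "links u js = L" "v0 = c + t"
  shows "linear v0 (snake u js) (L + replicate_mset c t)"
proof -
  note js = coverD[OF assms(1,2)]
  have "x mod t < t" for x using t_pos by simp
  then have "set (snake u js) = {0..<v0}" using set_snake[of js u] js by auto
  moreover have "distinct (snake u js)" using distinct_snake js by simp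
  ultimately show ?thesis using sum_height[OF js] assms by (simp add: linear_def steps_snake)
qed

section \<open>Distances between column ends\<close>

lemma gap_end_False [simp]: "gap (column_end False j) (column_end False k) = gap j k"
  by (simp add: column_end_def)

lemma gap_end_low: "j < r \<Longrightarrow> k < r \<Longrightarrow> gap (column_end u j) (column_end u k) = gap j k"
  by (simp add: column_end_def height_def gap_def)

lemma gap_end_high: "r \<le> j \<Longrightarrow> r \<le> k \<Longrightarrow> gap (column_end u j) (column_end u k) = gap j k"
  by (simp add: column_end_def height_def gap_def)

lemma q_mult: "r < t \<Longrightarrow> q * t = (q - 1) * t + t"
  using q_pos by (cases q) auto

text \<open>Column \<open>j\<close> ends one row above column \<open>k\<close>, so at the top it
  behaves like \<open>j + t\<close>. In particular \<open>t - 1\<close> and 0 are at distance 1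
  there.\<close>

lemma gap_end_cross: "j < r \<Longrightarrow> r \<le> k \<Longrightarrow> k < t \<Longrightarrow> gap (column_end True j) (column_end True k) = t + j - k"
  using q_mult by (simp add: column_end_def height_def gap_def)

lemma gap_end_cross': "j < r \<Longrightarrow> r \<le> k \<Longrightarrow> k < t \<Longrightarrow> gap (column_end True k) (column_end True j) = t + j - k"
  using gap_end_cross gap_commute by metis

lemma links_low: "set js \<subseteq> {..<r} \<Longrightarrow> links u js = steps gap js"
  by (induction u js rule: links.induct) (auto simp: gap_end_low)

lemma links_high: "set js \<subseteq> {r..} \<Longrightarrow> links u js = steps gap js"
  by (induction u js rule: links.induct) (auto simp: gap_end_high)

lemma column_end_top: "r \<ge> 1 \<Longrightarrow> column_end True (r - 1) = v0 - 1"
  using r_pos by (simp add: column_end_def height_def v0_def)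

lemma column_end_top2: "2 \<le> r \<Longrightarrow> column_end True (r - 2) = v0 - 2"
  by (simp add: column_end_def height_def v0_def)

text \<open>For \<open>r = 1\<close> the last row contains only \<open>v0 - 1\<close>, so
  \<open>v0 - 2\<close> ends the row before, in column \<open>t - 1\<close>.\<close>

lemma column_end_top2': "r = 1 \<Longrightarrow> 2 \<le> t \<Longrightarrow> column_end True (t - 1) = v0 - 2"
  unfolding column_end_def height_def v0_def using q_mult by simp

text \<open>The premise on \<open>u\<close> makes \<open>s\<close> the side of the link from
  \<open>j\<close> to \<open>k\<close>: top if true, bottom if false.\<close>

lemma adjacent_snake:
  assumes "js = xs @ [j, k] @ ys" "u = even (length xs) \<longleftrightarrow> s"
  shows "adjacent (snake u js) (column_end s j) (column_end s k)"
proof -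
  define A B where "A = (if s then column j else rev (column j))" and "B = (if \<not> s then column k else rev (column k))"
  have "A \<noteq> []" "last A = column_end s j" "B \<noteq> []" "hd B = column_end s k"
    by (auto simp: A_def B_def last_rev hd_rev)
  then have *: "A = butlast A @ [column_end s j]" "B = column_end s k # tl B"
    by (metis append_butlast_last_id, metis list.collapse)
  have s: "(u = even (length xs)) = s" using assms(2) by blast
  have "snake u js = snake u xs @ A @ B @ snake s ys"
    unfolding assms(1) snake_append s A_def B_def by simp
  also have "\<dots> = (snake u xs @ butlast A) @ [column_end s j, column_end s k] @ (tl B @ snake s ys)"
    by (subst *(1), subst *(2)) simp
  finally have "snake u js = (snake u xs @ butlast A) @ [column_end s j, column_end s k] @ (tl B @ snake s ys)" .
  then show ?thesis by (rule adjacentI)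
qed

end

declare One_nat_def [simp del]

section \<open>Linear realizations\<close>

lemma steps_run_hook_up:
  assumes "g \<le> g'" "2 \<le> n"
  shows "steps gap ([g..<g'] @ map (\<lambda>x. x + g') (hook_up n)) = replicate_mset (Suc (g' - g)) 1 + replicate_mset (n - 2) 2"
proof -
  note n = steps_gap_hook_up[OF assms(2)]
  show ?thesis
  proof (cases "g = g'")
    case False
    then have "Suc (g' - g - 1) = g' - g" "last [g..<g'] = g' - 1" using assms by (auto simp: last_upt)
    then show ?thesis using False assms n
      by (subst steps_append) (auto simp: hd_map steps_gap_upt gap_simps simp flip: replicate_mset_Suc)
  qed (simp add: n)
qed

lemma steps_hook_run:
  assumes "2 \<le> n" "n \<le> r"
  shows "steps gap (rev (hook n) @ [n..<r]) = replicate_mset (Suc (r - n)) 1 + replicate_mset (n - 2) 2"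
proof -
  note n = steps_gap_hook[OF assms(1)]
  show ?thesis
  proof (cases "n = r")
    case False
    then have "Suc (r - n - 1) = r - n" using assms by auto
    then show ?thesis using False assms n
      by (subst steps_append) (auto simp: last_rev steps_gap_upt gap_simps simp flip: replicate_mset_Suc)
  qed (use n in simp)
qed

lemma last_hook_run: "2 \<le> n \<Longrightarrow> n \<le> r \<Longrightarrow> last (rev (hook n) @ [n..<r]) = r - 1"
  by (cases "n = r") (auto simp: last_rev)

text \<open>Neighbours 0 and 1 become the two largest vertices in the mirror image.\<close>

lemma linear_insert_adjacent:
  assumes "linear v P L" "adjacent P (v - 2) (v - 1) \<or> adjacent P 0 1" "2 \<le> v"
  shows "\<exists>P'. linear (v + e) P' (L + replicate_mset e 2)"
proof -
  have "\<exists>P. linear v P L \<and> adjacent P (v - 2) (v - 1)"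
  proof (cases "adjacent P 0 1")
    case True
    then have "adjacent (map (\<lambda>x. v - 1 - x) P) (v - 2) (v - 1)"
      using adjacent_map[of P 0 1 "\<lambda>x. v - 1 - x"] adjacent_commute assms(3)
      by (simp add: numeral_2_eq_2)
    then show ?thesis using linear_mirror assms(1) by blast
  qed (use assms in auto)
  then show ?thesis using linear_insert_many assms(3) by blast
qed

context columns
begin

lemma adjacent_top:
  assumes "js = xs @ [r - 2, r - 1] @ ys" "2 \<le> r" "u = even (length xs)"
  shows "adjacent (snake u js) (v0 - 2) (v0 - 1)"
  using adjacent_snake[of js xs "r - 2" "r - 1" ys u True] assms column_end_top column_end_top2 r_pos by simp

lemma adjacent_bottom:
  assumes "js = xs @ [0, 1] @ ys \<or> js = xs @ [1, 0] @ ys" "u = odd (length xs)"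
  shows "adjacent (snake u js) 0 1"
  using adjacent_snake[of js xs 0 1 ys u False] adjacent_snake[of js xs 1 0 ys u False] assms adjacent_commute
  by (auto simp: column_end_def)

section \<open>All links of length 1\<close>

text \<open>Started upwards, the path links \<open>r - 1\<close> to \<open>r\<close> after
  \<open>r\<close> columns. This number is even, so the link is at the bottom.\<close>

lemma ones_even:
  assumes "even r"
  shows "links True [0..<t] = replicate_mset (t - 1) 1"
proof (cases "r = t")
  case True
  have "links True [0..<t] = steps gap [0..<t]" by (rule links_low) (use True in auto)
  then show ?thesis by (simp add: steps_gap_upt)
next
  case False
  then have "[0..<t] = [0..<r] @ [r..<t]" using r_le upt_add_eq_append[of 0 r "t - r"] by simp
  moreover have "t - 1 = Suc ((r - 1) + (t - r - 1))" using False r_le r_pos by simp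
  ultimately show ?thesis
    using assms False r_le r_pos
    by (simp add: links_append links_low links_high steps_gap_upt subset_iff gap_simps multiset_eq_iff)
qed

text \<open>The order 0, t - 1, ..., 1 opens with a link at the top. The link from \<open>r\<close>
  to \<open>r - 1\<close>, if \<open>r > 1\<close>, comes after \<open>t - r + 1\<close> columns, an
  even number, hence at the bottom.\<close>

lemma ones_odd:
  assumes "odd r" "even t"
  shows "links True (0 # rev [1..<t]) = replicate_mset (t - 1) 1"
proof -
  have "r < t" using assms r_le by (metis le_neq_implies_less)
  have hi: "links u (rev [r..<t]) = replicate_mset (t - r - 1) 1" "hd (rev [r..<t]) = t - 1" "last (rev [r..<t]) = r" for u
    using \<open>r < t\<close> by (simp_all add: links_high subset_iff steps_gap_upt hd_rev last_rev)
  have l: "links u (rev [1..<r]) = replicate_mset (r - 2) 1" for u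
    by (simp add: links_low subset_iff steps_gap_upt)
  have o: "odd (t - r)" using assms \<open>r < t\<close> by simp
  show ?thesis
  proof (cases "r = 1")
    case True
    then have "rev [1..<t] = rev [r..<t]" "r - 1 = 0" by simp_all
    moreover have "links True ([0] @ rev [r..<t]) = add_mset 1 (replicate_mset (t - r - 1) 1)"
      using hi \<open>r < t\<close> r_pos gap_end_cross[of 0 "t - 1"] by (subst links_append) simp_all
    moreover have "Suc (t - r - 1) = t - 1" using True \<open>r < t\<close> by simp
    ultimately show ?thesis by (metis append_Cons append_Nil replicate_mset_Suc)
  next
    case False
    have "rev [1..<t] = rev [r..<t] @ rev [1..<r]"
      using upt_add_eq_append[of 1 r "t - r"] \<open>r < t\<close> r_pos by simp
    moreover have "links True ([0] @ rev [r..<t] @ rev [1..<r]) = replicate_mset (t - 1) 1"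
      using hi l o False \<open>r < t\<close> r_pos gap_end_cross[of 0 "t - 1"]
      by (subst links_append, simp, simp, subst links_append)
        (simp_all add: hd_rev last_rev gap_simps multiset_eq_iff)
    ultimately show ?thesis by simp
  qed
qed

lemma ones_realization:
  assumes "even t" "v0 = c + t"
  shows "\<exists>P. linear v0 P (replicate_mset (t - 1) 1 + replicate_mset c t) \<and> P \<noteq> [] \<and> hd P = 0"
proof (cases "even r")
  case True
  have "{..<t} \<subseteq> set [0..<t]" by auto
  from linear_snake[OF this _ ones_even[OF True] assms(2)] t_pos show ?thesis
    by (intro exI[of _ "snake True [0..<t]"]) (auto simp: column_end_def hd_upt)
next
  case False
  have "{..<t} \<subseteq> set (0 # rev [1..<t])" by auto
  from linear_snake[OF this _ ones_odd[OF False assms(1)] assms(2)] t_pos show ?thesis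
    by (intro exI[of _ "snake True (0 # rev [1..<t])"]) (auto simp: column_end_def hd_rev simp del: snake.simps)
qed

section \<open>Column orders with hooks, for at least two edges of length 1\<close>

text \<open>The columns below \<open>a - 1\<close> are taken in order and the rest as a hook. As
  \<open>r < a\<close>, the hook uses only columns from \<open>r\<close> on, whose distances are the
  same at top and bottom. Starting with \<open>even r\<close> puts the link from
  \<open>r - 1\<close> to \<open>r\<close> at the bottom.\<close>

lemma hook_realization:
  assumes "2 \<le> a" "a + b + 1 = t" "r < a" "v0 = c + t"
  shows "\<exists>P. linear v0 P (replicate_mset a 1 + replicate_mset b 2 + replicate_mset c t) \<and>
    (adjacent P (v0 - 2) (v0 - 1) \<or> adjacent P 0 1)"
proof -
  let ?hs = "[r..<a - 1] @ map (\<lambda>x. x + (a - 1)) (hook_up (t - a + 1))"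
  let ?js = "[0..<r] @ ?hs"
  have hs: "links u ?hs = replicate_mset (Suc (a - 1 - r)) 1 + replicate_mset b 2" for u
  proof -
    have "t - a + 1 - 2 = b" "r \<le> a - 1" "2 \<le> t - a + 1" using assms by auto
    from steps_run_hook_up[OF this(2,3)] this show ?thesis by (subst links_high) auto
  qed
  have hd: "hd ?hs = r" "?hs \<noteq> []" using assms by (cases "r = a - 1"; simp add: hd_map)+
  have "links (even r) ?js = replicate_mset (r - 1) 1 + add_mset 1 (links True ?hs)"
    using r_pos hd by (subst links_append) (auto simp: links_low subset_iff steps_gap_upt gap_simps)
  then have links: "links (even r) ?js = replicate_mset a 1 + replicate_mset b 2"
    using hs assms r_pos by (simp add: multiset_eq_iff)
  have cov: "{..<t} \<subseteq> set ?js"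
  proof
    fix x assume "x \<in> {..<t}"
    then have "x < r \<or> r \<le> x \<and> x < a - 1 \<or> (x = (x - (a - 1)) + (a - 1) \<and> x - (a - 1) < t - a + 1)"
      using assms by auto
    then show "x \<in> set ?js" by auto
  qed
  have len: "length ?js = t" using assms by simp
  have "adjacent (snake (even r) ?js) (v0 - 2) (v0 - 1) \<or> adjacent (snake (even r) ?js) 0 1"
  \<comment> \<open>For \<open>r = 1\<close> the bottom link joins the vertices 0 and 1. Otherwise
    the link before it, from \<open>r - 2\<close> to \<open>r - 1\<close>, is at the top and joins
    \<open>v0 - 2\<close> to \<open>v0 - 1\<close>.\<close>
  proof (cases "r = 1")
    case True
    then have r0: "[0..<r] = [0]" by (simp add: One_nat_def)
    obtain x ys where x: "?hs = x # ys" using hd(2) unfolding neq_Nil_conv by blast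
    have "x = r" using hd(1) unfolding x list.sel .
    then have "x = 1" using True by (rule trans)
    have "?js = [0] @ x # ys" unfolding r0 x by (rule refl)
    then have js: "?js = [] @ [0, 1] @ ys" unfolding \<open>x = 1\<close> append_Cons append_Nil .
    have "even r = odd (length [])" using True by simp
    from adjacent_bottom[OF disjI1[OF js] this] show ?thesis by (rule disjI2)
  next
    case False
    define m where "m = r - 2"
    have m: "r = Suc (Suc m)" using False r_pos by (simp add: m_def)
    then have "?js = [0..<m] @ [r - 2, r - 1] @ ?hs" by (simp add: One_nat_def)
    then show ?thesis using adjacent_top[of ?js "[0..<m]" ?hs "even r"] m by simp
  qed
  then show ?thesis using linear_snake[OF cov len links assms(4)] by blast
qed

text \<open>For \<open>a \<le> r\<close> the low columns start with a hook too. They end in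
  \<open>r - 2, r - 1\<close> except possibly when \<open>a = 2\<close> and
  \<open>2 < r < t\<close>, where the hook fills all low columns.\<close>

lemma double_hook_realization:
  assumes "2 \<le> a" "a + b + 1 = t" "a \<le> r" "v0 = c + t" "4 \<le> t"
  shows "\<exists>P. linear v0 P (replicate_mset a 1 + replicate_mset b 2 + replicate_mset c t) \<and>
    (3 \<le> a \<or> r = 2 \<or> r = t \<longrightarrow> adjacent P (v0 - 2) (v0 - 1))"
proof -
  \<comment> \<open>The low hook and the run after it have \<open>r - n + 1\<close> edges of length
    1. The high part supplies one more unless \<open>r = t\<close>, where it is empty.\<close>
  define n where "n = (if r < t then r + 2 - a else r + 1 - a)"
  have n: "2 \<le> n" "n \<le> r" using assms r_le by (auto simp: n_def)
  let ?ls = "rev (hook n) @ [n..<r]"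
  let ?hs = "map (\<lambda>x. x + r) (rev (hook_up (t - r)))"
  let ?js = "?ls @ ?hs"
  have ls: "links u ?ls = replicate_mset (Suc (r - n)) 1 + replicate_mset (n - 2) 2" for u
    using n steps_hook_run[OF n] by (subst links_low) auto
  have links: "links (even r) ?js = replicate_mset a 1 + replicate_mset b 2"
  proof (cases "r = t")
    case True
    then have "?hs = []" "Suc (r - n) = a" "n - 2 = b" using assms by (auto simp: n_def hook_up_def)
    then show ?thesis by (simp only: append_Nil2 ls)
  next
    case False
    then have "r < t" using r_le by simp
    have hs: "links u ?hs = steps gap (hook_up (t - r))" for u
      by (subst links_high) (auto simp flip: rev_map)
    have hd: "hd ?hs = r + (t - r - 1 - (t - r - 2))" using \<open>r < t\<close> by (simp add: hd_map hd_rev)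
    have "links (even r) ?js = links (even r) ?ls + add_mset (gap (r - 1) (hd ?hs)) (steps gap (hook_up (t - r)))"
      using \<open>r < t\<close> n hs by (subst links_append) (auto simp: last_hook_run simp del: last_append)
    \<comment> \<open>A single high column is reached by a link of length 1. Several are reached by
      a link of length 2, and their hook contains the edge of length 1. The totals agree.\<close>
    moreover have "add_mset (gap (r - 1) (hd ?hs)) (steps gap (hook_up (t - r))) = add_mset 1 (replicate_mset (t - r - 1) 2)"
    proof (cases "t - r = 1")
      case True
      then show ?thesis using hd r_pos by (simp add: hook_up_def gap_simps One_nat_def)
    next
      case False
      then have "2 \<le> t - r" using \<open>r < t\<close> by simp
      moreover from this have "hd ?hs = r + 1" "t - r - 1 = Suc (t - r - 2)" using hd by auto
      ultimately show ?thesis using r_pos by (simp add: steps_gap_hook_up gap_simps del: map_map)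
    qed
    moreover have "a = Suc (Suc (r - n))" "b = (n - 2) + (t - r - 1)"
      using \<open>r < t\<close> assms by (simp_all add: n_def)
    ultimately show ?thesis unfolding ls by (simp add: multiset_eq_iff)
  qed
  have cov: "{..<t} \<subseteq> set ?js"
  proof
    fix x assume "x \<in> {..<t}"
    then have "x < n \<or> n \<le> x \<and> x < r \<or> (x = (x - r) + r \<and> x - r < t - r)"
      using assms by auto
    then show "x \<in> set ?js" by auto
  qed
  have len: "length ?js = t" using n r_le by simp
  have "adjacent (snake (even r) ?js) (v0 - 2) (v0 - 1)" if a: "3 \<le> a \<or> r = 2 \<or> r = t"
  proof -
    have "\<exists>xs. ?ls = xs @ [r - 2, r - 1]"
    proof (cases "n = r")
      case True
      then have "r = 2" using a assms by (auto simp: n_def split: if_splits)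
      then show ?thesis using True by (auto simp: numeral_2_eq_2 One_nat_def)
    next
      case False
      let ?l = "rev (hook n) @ [n..<r - 1]"
      have "?ls = ?l @ [r - 1]" using False n by (cases r) (auto simp: One_nat_def)
      moreover have "?l = butlast ?l @ [r - 2]"
        using last_hook_run[of n "r - 1"] append_butlast_last_id[of ?l] False n by (simp add: numeral_2_eq_2 One_nat_def)
      ultimately have "?ls = butlast ?l @ [r - 2, r - 1]" by (metis append.assoc append_Cons append_Nil)
      then show ?thesis by blast
    qed
    then obtain xs where xs: "?ls = xs @ [r - 2, r - 1]" by blast
    have "length ?ls = length (xs @ [r - 2, r - 1])" by (simp only: xs)
    then have "length xs + 2 = r" using n by simp
    then have "even r = even (length xs)" by presburger
    moreover have "?js = xs @ [r - 2, r - 1] @ ?hs" unfolding xs by simp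
    ultimately show ?thesis using adjacent_top[of ?js xs ?hs "even r"] \<open>length xs + 2 = r\<close> by simp
  qed
  then show ?thesis using linear_snake[OF cov len links assms(4)] by blast
qed


section \<open>Column orders made of runs in steps of 2\<close>

lemma links_by_twos_low:
  assumes "a + 2 * (n - 1) < r"
  shows "links u (by_twos a n) = replicate_mset (n - 1) 2" "links u (rev (by_twos a n)) = replicate_mset (n - 1) 2"
proof -
  have "set (by_twos a n) \<subseteq> {..<r}"
  proof
    fix x assume "x \<in> set (by_twos a n)"
    then obtain i where "x = a + 2 * i" "i < n" by (auto simp: by_twos_def)
    then show "x \<in> {..<r}" using assms by simp
  qed
  then show "links u (by_twos a n) = replicate_mset (n - 1) 2" "links u (rev (by_twos a n)) = replicate_mset (n - 1) 2"
    by (simp_all add: links_low)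
qed

lemma links_by_twos_high:
  assumes "r \<le> a"
  shows "links u (by_twos a n) = replicate_mset (n - 1) 2" "links u (rev (by_twos a n)) = replicate_mset (n - 1) 2"
proof -
  have "set (by_twos a n) \<subseteq> {r..}" using assms by (auto simp: in_set_by_twos)
  then show "links u (by_twos a n) = replicate_mset (n - 1) 2" "links u (rev (by_twos a n)) = replicate_mset (n - 1) 2"
    by (simp_all add: links_high)
qed

lemma links_Cons: "ys \<noteq> [] \<Longrightarrow> links u (x # ys) = add_mset (gap (column_end u x) (column_end u (hd ys))) (links (\<not> u) ys)"
  by (cases ys) auto

lemmas links_simps = links_append links_Cons links_by_twos_low links_by_twos_high hd_rev last_rev gap_simps gap_end_low gap_end_high

text \<open>The order is 2, 4, ..., t - 2, 0, 1, t - 1, ..., 3. The links from \<open>t - 2\<close>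
  to 0 and from 1 to \<open>t - 1\<close> are at the top, where they have length 2.\<close>

lemma single_one_r_2:
  assumes "even t" "4 \<le> t" "r = 2" "v0 = c + t"
  shows "\<exists>P. linear v0 P (add_mset 1 (replicate_mset (t - 2) 2) + replicate_mset c t) \<and> adjacent P 0 1"
proof -
  define m where "m = t div 2 - 2"
  have t: "t = 2 * m + 4" using assms by (auto simp: m_def)
  let ?js = "by_twos 2 (Suc m) @ [0, 1] @ rev (by_twos 3 (Suc m))"
  have cross: "gap (column_end True (2 + 2 * m)) (column_end True 0) = 2" "gap (column_end True 1) (column_end True (3 + 2 * m)) = 2"
    using gap_end_cross'[of 0 "2 + 2 * m"] gap_end_cross[of 1 "3 + 2 * m"] assms(3) t by simp_all
  have low: "\<And>j. j < 2 \<Longrightarrow> j < r" and high: "\<And>j. 2 \<le> j \<Longrightarrow> r \<le> j"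
    using assms by simp_all
  from cross have "links (odd (Suc m)) ?js = add_mset 1 (replicate_mset (2 * m + 2) 2)"
    by (simp add: links_simps low high multiset_eq_iff)
  moreover have "t - 2 = 2 * m + 2" using t by simp
  ultimately have links: "links (odd (Suc m)) ?js = add_mset 1 (replicate_mset (t - 2) 2)" by metis
  have cov: "{..<t} \<subseteq> set ?js"
    using t by (auto simp: in_set_by_twos_iff)
  have "adjacent (snake (odd (Suc m)) ?js) 0 1"
    by (rule adjacent_bottom[where xs = "by_twos 2 (Suc m)"]) auto
  then show ?thesis using linear_snake[OF cov _ links assms(4)] t by auto
qed

text \<open>The odd columns come first, then the even ones. The link from \<open>t - 1\<close> to 0
  is at the top, where it has length 1 and joins the two largest vertices.\<close>

lemma single_one_r_1:
  assumes "even t" "4 \<le> t" "r = 1" "v0 = c + t"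
  shows "\<exists>P. linear v0 P (add_mset 1 (replicate_mset (t - 2) 2) + replicate_mset c t) \<and> adjacent P (v0 - 2) (v0 - 1)"
proof -
  define m where "m = t div 2 - 2"
  have t: "t = 2 * m + 4" using assms by (auto simp: m_def)
  let ?js = "by_twos 1 (Suc m) @ [3 + 2 * m, 0] @ by_twos 2 (Suc m)"
  have cross: "gap (column_end True (3 + 2 * m)) (column_end True 0) = 1"
    using gap_end_cross'[of 0 "3 + 2 * m"] assms(3) t by simp
  have low: "\<And>j. j < 1 \<Longrightarrow> j < r" and high: "\<And>j. 1 \<le> j \<Longrightarrow> r \<le> j"
    using assms by simp_all
  from cross have "links (even (Suc m)) ?js = add_mset 1 (replicate_mset (2 * m + 2) 2)"
    by (simp add: links_simps low high multiset_eq_iff)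
  moreover have "t - 2 = 2 * m + 2" using t by simp
  ultimately have links: "links (even (Suc m)) ?js = add_mset 1 (replicate_mset (t - 2) 2)" by metis
  have cov: "{..<t} \<subseteq> set ?js"
    using t by (auto simp: in_set_by_twos_iff)
  have "column_end True (3 + 2 * m) = v0 - 2" using column_end_top2' t assms(3) by simp
  moreover have "column_end True 0 = v0 - 1" using column_end_top assms(3) by simp
  ultimately have "adjacent (snake (even (Suc m)) ?js) (v0 - 2) (v0 - 1)"
    using adjacent_snake[of ?js "by_twos 1 (Suc m)" "3 + 2 * m" 0 "by_twos 2 (Suc m)" "even (Suc m)" True] by simp
  then show ?thesis using linear_snake[OF cov _ links assms(4)] t by auto
qed

text \<open>The order is 3, 5, ..., t - 1, 1, 0, 2, 4, ..., t - 2, with the return from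
  \<open>t - 1\<close> to 1 at the top.\<close>

lemma single_one_r_3:
  assumes "even t" "4 \<le> t" "r = 3" "v0 = c + t"
  shows "\<exists>P. linear v0 P (add_mset 1 (replicate_mset (t - 2) 2) + replicate_mset c t) \<and> adjacent P 0 1"
proof -
  define m where "m = t div 2 - 2"
  have t: "t = 2 * m + 4" using assms by (auto simp: m_def)
  let ?js = "by_twos 3 (Suc m) @ [1, 0] @ 2 # by_twos 4 m"
  have cross: "gap (column_end True (3 + 2 * m)) (column_end True 1) = 2"
    using gap_end_cross'[of 1 "3 + 2 * m"] assms(3) t by simp
  have low: "\<And>j. j < 3 \<Longrightarrow> j < r" and high: "\<And>j. 3 \<le> j \<Longrightarrow> r \<le> j"
    using assms by simp_all
  from cross have "links (odd (Suc m)) ?js = add_mset 1 (replicate_mset (2 * m + 2) 2)"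
    by (cases "m = 0") (simp_all add: links_simps low high multiset_eq_iff)
  moreover have "t - 2 = 2 * m + 2" using t by simp
  ultimately have links: "links (odd (Suc m)) ?js = add_mset 1 (replicate_mset (t - 2) 2)" by metis
  have cov: "{..<t} \<subseteq> set ?js"
    using t by (auto simp: in_set_by_twos_iff)
  have "adjacent (snake (odd (Suc m)) ?js) 0 1"
    by (rule adjacent_bottom[where xs = "by_twos 3 (Suc m)"]) auto
  then show ?thesis using linear_snake[OF cov _ links assms(4)] t by auto
qed

text \<open>The order is that of \<open>r = 3\<close>. Here the crossings from \<open>r - 2\<close>
  to \<open>r\<close> and, if \<open>r + 1 < t\<close>, from \<open>r - 1\<close> to
  \<open>r + 1\<close> must be at the bottom, as \<open>4 dvd t\<close> ensures.\<close>

lemma single_one_r_mod_4_eq_3: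
  assumes "4 dvd t" "r mod 4 = 3" "r \<noteq> 3" "v0 = c + t"
  shows "\<exists>P. linear v0 P (add_mset 1 (replicate_mset (t - 2) 2) + replicate_mset c t) \<and> adjacent P 0 1"
proof -
  define k where "k = r div 4 - 1"
  have r: "r = 4 * k + 7" using assms by (simp add: k_def) presburger
  define n where "n = (t - r) div 4"
  have t: "t = 4 * k + 8 + 4 * n" using assms(1) r r_le by (simp add: n_def) presburger
  let ?js = "by_twos 3 (2 * k + 2) @ by_twos (4 * k + 7) (2 * n + 1) @ [1, 0] @ by_twos 2 (2 * k + 3) @ by_twos (4 * k + 8) (2 * n)"
  have cross: "gap (column_end True (4 * k + 7 + 4 * n)) (column_end True 1) = 2"
    using gap_end_cross'[of 1 "4 * k + 7 + 4 * n"] r t by simp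
  have low: "\<And>j. j < 4 * k + 7 \<Longrightarrow> j < r" and high: "\<And>j. 4 * k + 7 \<le> j \<Longrightarrow> r \<le> j"
    using r by simp_all
  from cross have "links True ?js = add_mset 1 (replicate_mset (4 * k + 6 + 4 * n) 2)"
    by (cases "n = 0") (simp_all add: links_simps low high multiset_eq_iff)
  moreover have "t - 2 = 4 * k + 6 + 4 * n" using t by simp
  ultimately have links: "links True ?js = add_mset 1 (replicate_mset (t - 2) 2)" by metis
  have cov: "{..<t} \<subseteq> set ?js"
    using t by (auto simp: in_set_by_twos_iff)
  have "adjacent (snake True ?js) 0 1"
    by (rule adjacent_bottom[where xs = "by_twos 3 (2 * k + 2) @ by_twos (4 * k + 7) (2 * n + 1)"]) auto
  then show ?thesis using linear_snake[OF cov _ links assms(4)] t by auto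
qed

text \<open>The even columns ascend, the low odd ones descend to 1, and \<open>t - 1\<close> is
  reached from there at the top. The turn from \<open>r - 1\<close> to \<open>r - 2\<close> is also
  at the top. Starting at 0 makes the path usable for \<open>a = 2\<close> as well as for
  \<open>a = 1\<close>.\<close>

lemma single_one_r_last:
  assumes "t mod 4 = 2" "4 \<le> t" "r = t - 1" "v0 = c + t"
  shows "\<exists>P. linear v0 P (add_mset 1 (replicate_mset (t - 2) 2) + replicate_mset c t) \<and> adjacent P (v0 - 2) (v0 - 1)
    \<and> P \<noteq> [] \<and> hd P = 0"
proof -
  define k where "k = t div 4 - 1"
  have t: "t = 4 * k + 6" using assms by (simp add: k_def) presburger
  let ?js = "by_twos 0 (2 * k + 2) @ [4 * k + 4, 4 * k + 3] @ rev (by_twos 1 (2 * k + 1)) @ [4 * k + 5]"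
  have cross: "gap (column_end True 1) (column_end True (4 * k + 5)) = 2"
    using gap_end_cross[of 1 "4 * k + 5"] assms(3) t by simp
  have low: "\<And>j. j < 4 * k + 5 \<Longrightarrow> j < r" and high: "\<And>j. 4 * k + 5 \<le> j \<Longrightarrow> r \<le> j"
    using assms t by simp_all
  from cross have "links True ?js = add_mset 1 (replicate_mset (4 * k + 4) 2)"
    by (simp add: links_simps low high multiset_eq_iff)
  moreover have "t - 2 = 4 * k + 4" using t by simp
  ultimately have links: "links True ?js = add_mset 1 (replicate_mset (t - 2) 2)" by metis
  have cov: "{..<t} \<subseteq> set ?js"
    using t by (auto simp: in_set_by_twos_iff)
  have e: "r - 1 = 4 * k + 4" "r - 2 = 4 * k + 3" "1 \<le> r" "2 \<le> r" using t assms(3) by simp_all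
  have "column_end True (4 * k + 4) = v0 - 1" "column_end True (4 * k + 3) = v0 - 2"
    using column_end_top column_end_top2 e by simp_all
  then have "adjacent (snake True ?js) (v0 - 1) (v0 - 2)"
    using adjacent_snake[of ?js "by_twos 0 (2 * k + 2)" "4 * k + 4" "4 * k + 3" "rev (by_twos 1 (2 * k + 1)) @ [4 * k + 5]" True True]
    by simp
  then have "adjacent (snake True ?js) (v0 - 2) (v0 - 1)" by (subst adjacent_commute)
  moreover have "snake True ?js \<noteq> [] \<and> hd (snake True ?js) = 0" by (simp add: column_end_def)
  ultimately show ?thesis using linear_snake[OF cov _ links assms(4)] t by (intro exI[of _ "snake True ?js"]) simp
qed

text \<open>From \<open>t - 1\<close> the path enters at the top a hook that leads from column 1 to
  column 0; any other crossing between low and high columns is at the bottom. For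
  \<open>a = 2\<close> the second edge of length 1 is attached at the end 0.\<close>

lemma hook_at_zero:
  assumes "even t" "r mod 4 = 3" "v0 = c + t"
  shows "\<exists>P. linear v0 P (add_mset 1 (replicate_mset (t - 2) 2) + replicate_mset c t) \<and> P \<noteq> [] \<and> hd P = 0"
proof -
  define k where "k = r div 4"
  have r: "r = 4 * k + 3" using assms by (simp add: k_def) presburger
  define m where "m = (t - r) div 2"
  have t: "t = 4 * k + 4 + 2 * m" using assms(1) r r_le by (simp add: m_def) presburger
  let ?js = "[4 * k + 3 + 2 * m] @ by_twos 1 (2 * k + 1) @ by_twos (4 * k + 3) m @ rev (by_twos (4 * k + 4) m) @ rev (by_twos 0 (2 * k + 2))"
  have cross: "gap (column_end True (4 * k + 3 + 2 * m)) (column_end True 1) = 2"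
    using gap_end_cross'[of 1 "4 * k + 3 + 2 * m"] r t by simp
  have low: "\<And>j. j < 4 * k + 3 \<Longrightarrow> j < r" and high: "\<And>j. 4 * k + 3 \<le> j \<Longrightarrow> r \<le> j"
    using r by simp_all
  from cross have "links True ?js = add_mset 1 (replicate_mset (4 * k + 2 + 2 * m) 2)"
    by (cases m) (simp_all add: links_simps low high multiset_eq_iff)
  moreover have "t - 2 = 4 * k + 2 + 2 * m" using t by simp
  ultimately have links: "links True ?js = add_mset 1 (replicate_mset (t - 2) 2)" by metis
  have cov: "{..<t} \<subseteq> set ?js"
    using t by (auto simp: in_set_by_twos_iff)
  have "rev (snake True ?js) \<noteq> []" "hd (rev (snake True ?js)) = 0"
    by (simp_all add: column_end_def hd_rev last_rev del: snake.simps)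
  then show ?thesis using linear_rev[OF linear_snake[OF cov _ links assms(3)]] t by (intro exI[of _ "rev (snake True ?js)"]) simp
qed

text \<open>The low columns turn at 0, 1, the high ones form a hook; each contributes one edge of
  length 1. The crossing from \<open>r - 2\<close> to \<open>r\<close> is at the bottom.\<close>

lemma two_ones_r_mod_4_eq_1:
  assumes "even t" "r mod 4 = 1" "r \<noteq> 1" "r + 3 \<le> t" "v0 = c + t"
  shows "\<exists>P. linear v0 P (replicate_mset 2 1 + replicate_mset (t - 3) 2 + replicate_mset c t) \<and> adjacent P 0 1"
proof -
  define k where "k = r div 4 - 1"
  have r: "r = 4 * k + 5" using assms by (simp add: k_def) presburger
  define n where "n = t - r"
  have t: "t = 4 * k + 5 + n" "2 \<le> n" using assms r by (simp_all add: n_def)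
  let ?hs = "map (\<lambda>x. x + (4 * k + 5)) (hook_up n)"
  let ?js = "rev (by_twos 2 (2 * k + 2)) @ [0, 1] @ by_twos 3 (2 * k + 1) @ ?hs"
  have hs: "links u ?hs = add_mset 1 (replicate_mset (n - 2) 2)" for u
    using t r steps_gap_hook_up[of n] by (subst links_high) auto
  have hd: "hd ?hs = 4 * k + 5" "?hs \<noteq> []" using t by (simp_all add: hd_map)
  have low: "\<And>j. j < 4 * k + 5 \<Longrightarrow> j < r" and high: "\<And>j. 4 * k + 5 \<le> j \<Longrightarrow> r \<le> j"
    using r by simp_all
  have "links False ?js = add_mset 1 (add_mset 1 (replicate_mset (4 * k + 4 + (n - 2)) 2))"
    using hs hd by (simp add: links_simps low high multiset_eq_iff del: map_is_Nil_conv)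
  moreover have "t - 3 = 4 * k + 4 + (n - 2)" using t by simp
  ultimately have links: "links False ?js = replicate_mset 2 1 + replicate_mset (t - 3) 2"
    by (simp add: numeral_2_eq_2)
  have cov: "{..<t} \<subseteq> set ?js"
  proof
    fix x assume "x \<in> {..<t}"
    then have "x < 4 * k + 5 \<or> (x = (x - (4 * k + 5)) + (4 * k + 5) \<and> x - (4 * k + 5) < n)"
      using t by auto
    then show "x \<in> set ?js"
    proof
      assume "x < 4 * k + 5"
      moreover have "x = 0 \<or> x = 1 \<or> 2 \<le> x \<and> even x \<or> 3 \<le> x \<and> odd x" by presburger
      ultimately show ?thesis by (auto simp: in_set_by_twos)
    qed (simp; blast)
  qed
  have "adjacent (snake False ?js) 0 1"
    by (rule adjacent_bottom[where xs = "rev (by_twos 2 (2 * k + 2))"]) auto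
  then show ?thesis using linear_snake[OF cov _ links assms(5)] t by auto
qed

end

section \<open>Cyclic realizations\<close>

lemma steps_extend_up:
  assumes "A \<noteq> []" "\<And>x. f x (x + 2) = 2" "last A + 2 = n"
  shows "steps f (A @ by_twos n k) = steps f A + replicate_mset k 2 \<and> last (A @ by_twos n k) + 2 = n + 2 * k"
proof (cases k)
  case (Suc m)
  have "steps f (by_twos n k) = replicate_mset m 2" using steps_by_twos[of n k f] assms(2) Suc by simp
  then show ?thesis using assms Suc by (auto simp: steps_append)
qed (use assms in simp)

lemma steps_extend_down:
  assumes "A \<noteq> []" "\<And>x. f x (x + 2) = 2" "\<And>x y. f x y = f y x" "hd A + 2 = n"
  shows "steps f (rev (by_twos n k) @ A) = steps f A + replicate_mset k 2 \<and> hd (rev (by_twos n k) @ A) + 2 = n + 2 * k"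
proof -
  have "rev (by_twos n k) @ A = rev (rev A @ by_twos n k)" by simp
  moreover have "steps f (rev A @ by_twos n k) = steps f (rev A) + replicate_mset k 2 \<and> last (rev A @ by_twos n k) + 2 = n + 2 * k"
    using steps_extend_up[of "rev A" f n k] assms by (simp add: last_rev)
  ultimately show ?thesis using steps_rev[of f, OF assms(3)] assms(1)
    by (metis hd_rev append_is_Nil_conv rev_is_Nil_conv)
qed

lemma edge_len_step: "4 \<le> v \<Longrightarrow> edge_len v x (x + 2) = 2"
  by (simp add: edge_len_gap gap_def)

lemma edge_len_wrap: "4 \<le> v \<Longrightarrow> edge_len v (v - 2) 0 = 2" "4 \<le> v \<Longrightarrow> edge_len v (v - 1) 1 = 2"
  by (simp_all add: edge_len_gap gap_def)

lemma set_strand: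
  "set (by_twos n k) \<union> set (by_twos (n + 1) k) = {n..<n + 2 * k}"
  "set (by_twos n (k + 1)) \<union> set (by_twos (n + 1) k) = {n..<n + (2 * k + 1)}"
  by (auto simp: set_eq_iff in_set_by_twos_iff) presburger+

lemma distinct_of_set:
  assumes "set P = {0..<v}" "length P = v"
  shows "distinct P"
  using assms by (simp add: card_distinct)

lemma realizable_steps:
  assumes "set P = {0..<v}" "length P = v" "steps (edge_len v) P = L"
  shows "realizable v L"
  using assms distinct_of_set[OF assms(1,2)]
  by (auto simp: realizable_def ham_path_def path_lengths_steps)

text \<open>Both strands lead from the largest vertices \<open>n - 2\<close>, \<open>n - 1\<close> through the new vertices to \<open>0\<close> and \<open>1\<close>.\<close>

lemma strands_across:
  assumes "A \<noteq> []" "B \<noteq> []" "C \<noteq> []"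
    and "set (A @ B @ C) = {0..<n}" "length (A @ B @ C) = n"
    and "last A + 2 = n" "hd B = 0" "last B + 1 = n" "hd C = 1"
    and "\<And>x. x \<in># steps gap A + steps gap B + steps gap C \<Longrightarrow> x \<le> (n + 2 * k) div 2" "4 \<le> n"
  shows "realizable (n + 2 * k) (steps gap A + steps gap B + steps gap C + replicate_mset (2 * k + 2) 2)"
proof -
  let ?v = "n + 2 * k"
  let ?f = "edge_len ?v"
  have eq: "steps ?f A = steps gap A" "steps ?f B = steps gap B" "steps ?f C = steps gap C"
    by (rule steps_edge_len, rule assms(10), simp)+
  have f: "?f x (x + 2) = 2" for x
    by (rule edge_len_step) (use assms(11) in simp)
  have w: "?f (?v - 2) 0 = 2" "?f (?v - 1) 1 = 2" using edge_len_wrap[of ?v] assms(11) by simp_all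
  note ext = steps_extend_up[of A ?f n k, OF assms(1) f assms(6)]
  have A: "steps ?f (A @ by_twos n k) = steps ?f A + replicate_mset k 2" "last (A @ by_twos n k) = ?v - 2"
    using ext by (rule conjunct1) (use conjunct2[OF ext] in linarith)
  have "last B + 2 = n + 1" using assms(8) by simp
  note ext = steps_extend_up[of B ?f "n + 1" k, OF assms(2) f this]
  have B: "steps ?f (B @ by_twos (n + 1) k) = steps ?f B + replicate_mset k 2" "last (B @ by_twos (n + 1) k) = ?v - 1"
    using ext by (rule conjunct1) (use conjunct2[OF ext] in linarith)
  define A' B' where "A' = A @ by_twos n k" and "B' = B @ by_twos (n + 1) k"
  have ne: "A' \<noteq> []" "B' \<noteq> []" "hd B' = 0" using assms(1,2,7) by (simp_all add: A'_def B'_def)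
  have "steps ?f (A' @ B' @ C) = steps ?f A' + add_mset 2 (steps ?f B' + add_mset 2 (steps ?f C))"
    using ne assms(3,9) A(2) B(2) w by (simp add: steps_append A'_def[symmetric] B'_def[symmetric])
  also have "\<dots> = steps gap A + steps gap B + steps gap C + replicate_mset (2 * k + 2) 2"
    using A(1) B(1) eq by (simp add: A'_def[symmetric] B'_def[symmetric] multiset_eq_iff)
  finally have sum: "steps ?f (A' @ B' @ C) = steps gap A + steps gap B + steps gap C + replicate_mset (2 * k + 2) 2" .
  have "set (A' @ B' @ C) = set (A @ B @ C) \<union> {n..<?v}"
    unfolding set_strand(1)[symmetric] A'_def B'_def by auto
  moreover have "{0..<n} \<union> {n..<?v} = {0..<?v}" by auto
  ultimately have "set (A' @ B' @ C) = {0..<?v}" using assms(4) by metis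
  moreover have "length (A' @ B' @ C) = ?v" using assms(5) by (simp add: A'_def B'_def)
  ultimately show ?thesis using sum by (rule realizable_steps)
qed

text \<open>The strands have opposite directions here, and the parity of \<open>e\<close> decides which ends they join, so \<open>B\<close> has to be reversed when \<open>e\<close> is even.\<close>

lemma strands_turning:
  assumes "A \<noteq> []" "B \<noteq> []" "C \<noteq> []"
    and "set (A @ B @ C) = {0..<n}" "length (A @ B @ C) = n"
    and "last A = 0" "hd B + 1 = n" "last B + 2 = n" "hd C = 1"
    and "\<And>x. x \<in># steps gap A + steps gap B + steps gap C \<Longrightarrow> x \<le> (n + e) div 2" "4 \<le> n"
  shows "realizable (n + e) (steps gap A + steps gap B + steps gap C + replicate_mset (e + 2) 2)"
proof -
  let ?v = "n + e"
  let ?f = "edge_len ?v"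
  have f: "?f x (x + 2) = 2" "?f x y = ?f y x" for x y
    by (rule edge_len_step) (use assms(11) in simp, rule edge_len_commute)
  have eq: "steps ?f A = steps gap A" "steps ?f B = steps gap B" "steps ?f C = steps gap C"
    by (rule steps_edge_len, rule assms(10), simp)+
  have "\<exists>Q. Q \<noteq> [] \<and> steps ?f Q = steps gap B + replicate_mset e 2 \<and> hd Q + 2 = ?v \<and> last Q + 1 = ?v \<and>
      set Q = set B \<union> {n..<?v} \<and> length Q = length B + e"
  proof (cases "even e")
    case True
    then obtain k where e: "e = 2 * k" by blast
    let ?B = "rev B @ by_twos (n + 1) k"
    have "last (rev B) + 2 = n + 1" using assms(2,7) by (simp add: last_rev)
    note up = steps_extend_up[of "rev B" ?f "n + 1" k, OF _ f(1) this]
    have "hd ?B + 2 = n" using assms(2,8) by (simp add: hd_rev)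
    note down = steps_extend_down[of ?B ?f n k, OF _ f this]
    have "steps ?f (rev (by_twos n k) @ ?B) = steps gap B + replicate_mset k 2 + replicate_mset k 2"
      using up down assms(2) steps_rev[of ?f B] f(2) eq(2) by simp
    also have "\<dots> = steps gap B + replicate_mset e 2" by (simp add: e multiset_eq_iff)
    finally have "steps ?f (rev (by_twos n k) @ ?B) = steps gap B + replicate_mset e 2" .
    moreover have "hd (rev (by_twos n k) @ ?B) + 2 = ?v" using down assms(2) e by simp
    moreover have "last (rev (by_twos n k) @ ?B) + 1 = ?v" using up assms(2) e by simp
    moreover have "set (rev (by_twos n k) @ ?B) = set B \<union> {n..<?v}"
      unfolding e set_strand(1)[symmetric] by auto
    moreover have "length (rev (by_twos n k) @ ?B) = length B + e" using e by simp
    ultimately show ?thesis using assms(2) by (intro exI[of _ "rev (by_twos n k) @ ?B"] conjI) simp_all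
  next
    case False
    then obtain k where e: "e = 2 * k + 1" by (elim oddE)
    let ?B = "B @ by_twos n (k + 1)"
    note up = steps_extend_up[of B ?f n "k + 1", OF assms(2) f(1) assms(8)]
    have "hd ?B + 2 = n + 1" using assms(2,7) by simp
    note down = steps_extend_down[of ?B ?f "n + 1" k, OF _ f this]
    have "steps ?f (rev (by_twos (n + 1) k) @ ?B) = steps gap B + replicate_mset (k + 1) 2 + replicate_mset k 2"
      using up down assms(2) eq(2) by simp
    also have "\<dots> = steps gap B + replicate_mset e 2" by (simp add: e multiset_eq_iff)
    finally have "steps ?f (rev (by_twos (n + 1) k) @ ?B) = steps gap B + replicate_mset e 2" .
    moreover have "hd (rev (by_twos (n + 1) k) @ ?B) + 2 = ?v" using down assms(2) e by simp
    moreover have "last (rev (by_twos (n + 1) k) @ ?B) + 1 = ?v" using up assms(2) e by simp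
    moreover have "set (rev (by_twos (n + 1) k) @ ?B) = set B \<union> {n..<?v}"
      unfolding e set_strand(2)[symmetric] by auto
    moreover have "length (rev (by_twos (n + 1) k) @ ?B) = length B + e" using e by simp
    ultimately show ?thesis using assms(2) by (intro exI[of _ "rev (by_twos (n + 1) k) @ ?B"] conjI) simp_all
  qed
  then obtain Q where Q: "Q \<noteq> []" "steps ?f Q = steps gap B + replicate_mset e 2" "hd Q = ?v - 2" "last Q = ?v - 1"
      "set Q = set B \<union> {n..<?v}" "length Q = length B + e"
    by (metis add_diff_cancel_right')
  let ?P = "A @ Q @ C"
  have "?f 0 (?v - 2) = 2" "?f (?v - 1) 1 = 2"
    using edge_len_wrap[of ?v] f(2)[of 0] assms(11) by simp_all
  then have sum: "steps ?f ?P = steps gap A + steps gap B + steps gap C + replicate_mset (e + 2) 2"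
    using Q eq assms(1-3,6,9) by (simp add: steps_append multiset_eq_iff)
  have "set ?P = set (A @ B @ C) \<union> {n..<?v}" using Q(5) by auto
  moreover have "{0..<n} \<union> {n..<?v} = {0..<?v}" by auto
  ultimately have "set ?P = {0..<?v}" using assms(4) by metis
  moreover have "length ?P = ?v" using Q(6) assms(5) by simp
  ultimately show ?thesis using sum by (rule realizable_steps)
qed

context columns
begin

section \<open>Column orders whose strands cross the gap of the cycle\<close>

lemma snake3:
  assumes "{..<t} \<subseteq> set (js @ ks @ ls)" "length (js @ ks @ ls) = t"
  shows "set (snake a js @ snake b ks @ snake c ls) = {0..<v0}" "length (snake a js @ snake b ks @ snake c ls) = v0"
    "v0 = d + t \<Longrightarrow> steps gap (snake a js) + steps gap (snake b ks) + steps gap (snake c ls) = links a js + links b ks + links c ls + replicate_mset d t"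
proof -
  note cov = coverD[OF assms]
  have sub: "set js \<subseteq> {..<t}" "set ks \<subseteq> {..<t}" "set ls \<subseteq> {..<t}" using cov(1) by auto
  have lt: "x mod t < t" for x using t_pos by simp
  show set: "set (snake a js @ snake b ks @ snake c ls) = {0..<v0}"
    using cov(1) lt sub by (auto simp: set_snake)
  have "distinct (snake a js @ snake b ks @ snake c ls)"
    using cov sub by (auto simp: distinct_snake set_snake)
  from distinct_card[OF this] set show "length (snake a js @ snake b ks @ snake c ls) = v0" by simp
  show "steps gap (snake a js) + steps gap (snake b ks) + steps gap (snake c ls) = links a js + links b ks + links c ls + replicate_mset d t"
    if "v0 = d + t"
    using sum_height[OF cov] that by (simp add: steps_snake multiset_eq_iff)
qed

lemma strand_bound:
  assumes "x \<in># add_mset 1 (replicate_mset n 2) + replicate_mset d t \<or>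
    x \<in># replicate_mset 2 1 + replicate_mset n 2 + replicate_mset d t"
  shows "x \<le> max 2 t"
  using assms by (auto split: if_splits)

text \<open>The parities turn the end columns \<open>r - 2\<close>, 0, \<open>r - 1\<close>, 1 into
  the vertices \<open>v0 - 2\<close>, 0, \<open>v0 - 1\<close>, 1 at which
  \<open>strands_across\<close> joins. Three snakes have only \<open>t - 3\<close> links.\<close>

lemma columns_across:
  assumes "4 \<le> t" "2 \<le> r" "v0 = d + t" "t \<le> (v0 + 2 * i) div 2"
    and cov: "{..<t} \<subseteq> set (js @ ks @ ls)" "length (js @ ks @ ls) = t"
    and ne: "js \<noteq> []" "ks \<noteq> []" "ls \<noteq> []"
    and ends: "last js = r - 2" "hd ks = 0" "last ks = r - 1" "hd ls = 1"
    and par: "u = odd (length js)" "odd (length ks)"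
    and links: "links u js + links True ks + links True ls = add_mset 1 (replicate_mset (t - 4) 2)"
  shows "realizable (v0 + 2 * i) (add_mset 1 (replicate_mset (t - 2 + 2 * i) 2) + replicate_mset d t)"
proof -
  note z = snake3[OF cov, where a = u and b = True and c = True]
  have sum: "steps gap (snake u js) + steps gap (snake True ks) + steps gap (snake True ls) =
    add_mset 1 (replicate_mset (t - 4) 2) + replicate_mset d t"
    unfolding z(3)[OF assms(3)] links ..
  have v: "2 \<le> v0" "4 \<le> v0" using assms(1-3) by (simp_all add: v0_def)
  have "last (snake u js) + 2 = v0" "hd (snake True ks) = 0" "last (snake True ks) + 1 = v0" "hd (snake True ls) = 1"
    using ne ends par v column_end_top[OF r_pos] column_end_top2[OF assms(2)] by (simp_all add: column_end_def[of False])
  note e = this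
  have "x \<le> (v0 + 2 * i) div 2" if "x \<in># steps gap (snake u js) + steps gap (snake True ks) + steps gap (snake True ls)" for x
  proof -
    have "x \<le> max 2 t" by (rule strand_bound[OF disjI1]) (use that in \<open>simp only: sum\<close>)
    then show ?thesis using assms(1,4) by simp
  qed
  from strands_across[OF _ _ _ z(1,2) e this v(2)] ne
  have "realizable (v0 + 2 * i) (add_mset 1 (replicate_mset (t - 4) 2) + replicate_mset d t + replicate_mset (2 * i + 2) 2)"
    unfolding sum by simp
  moreover have "add_mset 1 (replicate_mset (t - 4) 2) + replicate_mset d t + replicate_mset (2 * i + 2) 2 =
    add_mset 1 (replicate_mset (t - 2 + 2 * i) 2) + replicate_mset d t"
    using assms(1) by (simp add: multiset_eq_iff)
  ultimately show ?thesis by metis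
qed

text \<open>Here \<open>ks\<close> starts and ends at the top, hence leads from
  \<open>v0 - 1\<close> to \<open>v0 - 2\<close>. The two forms of \<open>K\<close> serve
  \<open>a = 1\<close> and \<open>a = 2\<close>.\<close>

lemma columns_turning:
  assumes "4 \<le> t" "2 \<le> r" "v0 = d + t" "t \<le> (v0 + e) div 2"
    and cov: "{..<t} \<subseteq> set (js @ ks @ ls)" "length (js @ ks @ ls) = t"
    and ne: "js \<noteq> []" "ks \<noteq> []" "ls \<noteq> []"
    and ends: "last js = 0" "hd ks = r - 1" "last ks = r - 2" "hd ls = 1"
    and par: "u = even (length js)" "even (length ks)"
    and links: "links u js + links False ks + links True ls = K"
    and K: "K = add_mset 1 (replicate_mset (t - 4) 2) \<or> K = replicate_mset 2 1 + replicate_mset (t - 5) 2"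
  shows "realizable (v0 + e) (K + replicate_mset d t + replicate_mset (e + 2) 2)"
proof -
  note z = snake3[OF cov, where a = u and b = False and c = True]
  have sum: "steps gap (snake u js) + steps gap (snake False ks) + steps gap (snake True ls) = K + replicate_mset d t"
    unfolding z(3)[OF assms(3)] links ..
  have v: "2 \<le> v0" "4 \<le> v0" using assms(1-3) by (simp_all add: v0_def)
  have "last (snake u js) = 0" "hd (snake False ks) + 1 = v0" "last (snake False ks) + 2 = v0" "hd (snake True ls) = 1"
    using ne ends par v column_end_top[OF r_pos] column_end_top2[OF assms(2)] by (simp_all add: column_end_def[of False])
  note e = this
  have "x \<le> (v0 + e) div 2" if "x \<in># steps gap (snake u js) + steps gap (snake False ks) + steps gap (snake True ls)" for x
  proof -
    have "x \<le> max 2 t" by (rule strand_bound) (use that[unfolded sum] K in \<open>auto split: if_splits\<close>)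
    then show ?thesis using assms(1,4) by simp
  qed
  from strands_turning[OF _ _ _ z(1,2) e this v(2)] ne
  show ?thesis unfolding sum by simp
qed

text \<open>The first snake turns between \<open>t - 2\<close> and \<open>t - 1\<close>, the only
  link of length 1, and drops from \<open>r\<close> to \<open>r - 2\<close> at the bottom. The other
  two are runs through low columns.\<close>

lemma strands_r_mod_4_eq_1:
  assumes "even t" "r mod 4 = 1" "r \<noteq> 1" "r + 3 \<le> t" "v0 = c + t" "t \<le> (v0 + 2 * i) div 2"
  shows "realizable (v0 + 2 * i) (add_mset 1 (replicate_mset (t - 2 + 2 * i) 2) + replicate_mset c t)"
proof -
  define k where "k = r div 4 - 1"
  have r: "r = 4 * k + 5" using assms(2,3) unfolding k_def by presburger
  define m where "m = (t - r - 3) div 2"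
  have t: "t = 4 * k + 8 + 2 * m" using assms(1-4) r unfolding m_def by presburger
  have low: "\<And>j. j < 4 * k + 5 \<Longrightarrow> j < r" and high: "\<And>j. 4 * k + 5 \<le> j \<Longrightarrow> r \<le> j"
    using r by simp_all
  let ?ja = "by_twos (4 * k + 6) (m + 1) @ rev (by_twos (4 * k + 5) (m + 2)) @ [4 * k + 3]"
  let ?jb = "by_twos 0 (2 * k + 3)" and ?jc = "by_twos 1 (2 * k + 1)"
  have "links False ?ja + links True ?jb + links True ?jc = add_mset 1 (replicate_mset (4 * k + 4 + 2 * m) 2)"
    by (simp add: links_simps low high multiset_eq_iff)
  moreover have "t - 4 = 4 * k + 4 + 2 * m" using t by simp
  ultimately have links: "links False ?ja + links True ?jb + links True ?jc = add_mset 1 (replicate_mset (t - 4) 2)" by metis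
  have cov: "{..<t} \<subseteq> set (?ja @ ?jb @ ?jc)"
    using t by (auto simp: in_set_by_twos_iff)
  have len: "length (?ja @ ?jb @ ?jc) = t" using t by simp
  show ?thesis
    by (rule columns_across[OF _ _ assms(5,6) cov len _ _ _ _ _ _ _ _ _ links]) (use r t in simp_all)
qed

text \<open>The first snake turns between 2 and 3 and stays low. From 0 and 1 the other two jump at
  the top to \<open>t - 2\<close> and \<open>t - 1\<close>; the return from \<open>r + 1\<close> to
  \<open>r - 1\<close> is at the bottom.\<close>

lemma strands_r_mod_4_eq_3:
  assumes "t mod 4 = 2" "r mod 4 = 3" "r \<noteq> 3" "v0 = c + t" "t \<le> (v0 + 2 * i) div 2"
  shows "realizable (v0 + 2 * i) (add_mset 1 (replicate_mset (t - 2 + 2 * i) 2) + replicate_mset c t)"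
proof -
  define k where "k = r div 4 - 1"
  have r: "r = 4 * k + 7" using assms(2,3) unfolding k_def by presburger
  define n where "n = (t - r) div 4"
  have "4 * k + 7 \<le> t" using r r_le by simp
  then have t: "t = 4 * k + 10 + 4 * n" using assms(1) unfolding n_def r by presburger
  have low: "\<And>j. j < 4 * k + 7 \<Longrightarrow> j < r" and high: "\<And>j. 4 * k + 7 \<le> j \<Longrightarrow> r \<le> j"
    using r by simp_all
  have cross: "gap (column_end True 0) (column_end True (4 * k + 8 + 4 * n)) = 2" "gap (column_end True 1) (column_end True (9 + (4 * k + 4 * n))) = 2"
    using gap_end_cross[of 0 "4 * k + 8 + 4 * n"] gap_end_cross[of 1 "9 + (4 * k + 4 * n)"] r t by simp_all
  let ?ja = "rev (by_twos 2 (2 * k + 2)) @ by_twos 3 (2 * k + 2)"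
  let ?jb = "0 # rev (by_twos (4 * k + 8) (2 * n + 1)) @ [4 * k + 6]"
  let ?jc = "1 # rev (by_twos (4 * k + 7) (2 * n + 2))"
  from cross have "links False ?ja + links True ?jb + links True ?jc = add_mset 1 (replicate_mset (4 * k + 6 + 4 * n) 2)"
    by (simp add: links_simps low high multiset_eq_iff)
  moreover have "t - 4 = 4 * k + 6 + 4 * n" using t by simp
  ultimately have links: "links False ?ja + links True ?jb + links True ?jc = add_mset 1 (replicate_mset (t - 4) 2)" by metis
  have cov: "{..<t} \<subseteq> set (?ja @ ?jb @ ?jc)"
    using t by (auto simp: in_set_by_twos_iff)
  have len: "length (?ja @ ?jb @ ?jc) = t" using t by simp
  show ?thesis
    by (rule columns_across[OF _ _ assms(4,5) cov len _ _ _ _ _ _ _ _ _ links]) (use r t in simp_all)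
qed

text \<open>The middle snake is a hook through the low columns from 2 on. The high columns are
  attached to 0 and 1 by links at the top.\<close>

lemma strands_r_even:
  assumes "even t" "even r" "4 \<le> r" "v0 = c + t" "t \<le> (v0 + e) div 2"
  shows "realizable (v0 + e) (add_mset 1 (replicate_mset (t - 2 + e) 2) + replicate_mset c t)"
    "r < t \<Longrightarrow> realizable (v0 + e) (replicate_mset 2 1 + replicate_mset (t - 3 + e) 2 + replicate_mset c t)"
proof -
  define m where "m = r div 2 - 2"
  have r: "r = 2 * m + 4" using assms(2,3) unfolding m_def by presburger
  have low: "\<And>j. j < 2 * m + 4 \<Longrightarrow> j < r" and high: "\<And>j. 2 * m + 4 \<le> j \<Longrightarrow> r \<le> j"
    using r by simp_all
  define p where "p = (t - r) div 2"
  have "2 * m + 4 \<le> t" using r r_le by simp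
  then have t: "t = 2 * m + 4 + 2 * p" using assms(1) unfolding p_def r by presburger
  let ?jb = "rev (by_twos 3 (m + 1)) @ by_twos 2 (m + 1)"
  have Jb: "links False ?jb = add_mset 1 (replicate_mset (2 * m) 2)"
    by (simp add: links_simps low high multiset_eq_iff)
  let ?jc = "1 # rev (by_twos (2 * m + 5) p)"
  show "realizable (v0 + e) (add_mset 1 (replicate_mset (t - 2 + e) 2) + replicate_mset c t)"
  proof -
    let ?ja = "by_twos (2 * m + 4) p @ [0]"
    have links: "links (odd p) ?ja = replicate_mset p 2 \<and> links True ?jc = replicate_mset p 2"
    proof (cases p)
      case (Suc i)
      have "gap (column_end True (2 * m + 4 + 2 * i)) (column_end True 0) = 2" "gap (column_end True 1) (column_end True (2 * m + 5 + 2 * i)) = 2"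
        using gap_end_cross'[of 0 "2 * m + 4 + 2 * i"] gap_end_cross[of 1 "2 * m + 5 + 2 * i"] r t Suc by simp_all
      then show ?thesis unfolding Suc by (simp add: links_simps low high multiset_eq_iff)
    qed simp
    then have "links (odd p) ?ja + links False ?jb + links True ?jc = add_mset 1 (replicate_mset (t - 4) 2)"
      using Jb t by (simp add: multiset_eq_iff)
    note links = this
    have cov: "{..<t} \<subseteq> set (?ja @ ?jb @ ?jc)"
      using t by (auto simp: in_set_by_twos_iff)
    have len: "length (?ja @ ?jb @ ?jc) = t" using t by simp
    have "realizable (v0 + e) (add_mset 1 (replicate_mset (t - 4) 2) + replicate_mset c t + replicate_mset (e + 2) 2)"
      by (rule columns_turning[OF _ _ assms(4,5) cov len _ _ _ _ _ _ _ _ _ links]) (use r t in \<open>simp_all add: hd_rev\<close>)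
    moreover have "add_mset 1 (replicate_mset (t - 4) 2) + replicate_mset c t + replicate_mset (e + 2) 2 =
       add_mset 1 (replicate_mset (t - 2 + e) 2) + replicate_mset c t"
      using t by (simp add: multiset_eq_iff)
    ultimately show ?thesis by metis
  qed
  show "realizable (v0 + e) (replicate_mset 2 1 + replicate_mset (t - 3 + e) 2 + replicate_mset c t)" if "r < t"
  proof -
    define i where "i = p - 1"
    have p: "p = Suc i" using that r t by (simp add: i_def)
    \<comment> \<open>Column \<open>r\<close> moves from the first snake to the end of the third,
      after \<open>r + 1\<close>. This creates the second edge of length 1.\<close>
    let ?ja = "by_twos (2 * m + 6) i @ [0]"
    let ?jd = "?jc @ [2 * m + 4]"
    have c2: "gap (column_end True 1) (column_end True (2 * m + 5 + 2 * i)) = 2"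
      using gap_end_cross[of 1 "2 * m + 5 + 2 * i"] r t p by simp
    have "links (odd i) ?ja = replicate_mset i 2"
    proof (cases i)
      case (Suc l)
      have "gap (column_end True (2 * m + 6 + 2 * l)) (column_end True 0) = 2"
        using gap_end_cross'[of 0 "2 * m + 6 + 2 * l"] r t p Suc by simp
      then show ?thesis unfolding Suc by (simp add: links_simps low high multiset_eq_iff)
    qed simp
    moreover have "links True ?jd = add_mset 1 (replicate_mset (Suc i) 2)"
      using c2 unfolding p by (simp add: links_simps low high multiset_eq_iff)
    moreover have "t - 5 = 2 * m + 2 * i + 1" using t p by simp
    ultimately have links: "links (odd i) ?ja + links False ?jb + links True ?jd = replicate_mset 2 1 + replicate_mset (t - 5) 2"
      using Jb by (simp add: multiset_eq_iff)
    have cov: "{..<t} \<subseteq> set (?ja @ ?jb @ ?jd)"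
      using t p by (auto simp: in_set_by_twos_iff)
    have len: "length (?ja @ ?jb @ ?jd) = t" using t p by simp
    have "realizable (v0 + e) (replicate_mset 2 1 + replicate_mset (t - 5) 2 + replicate_mset c t + replicate_mset (e + 2) 2)"
      by (rule columns_turning[OF _ _ assms(4,5) cov len _ _ _ _ _ _ _ _ _ links]) (use r t p in \<open>simp_all add: hd_rev\<close>)
    moreover have "replicate_mset 2 1 + replicate_mset (t - 5) 2 + replicate_mset c t + replicate_mset (e + 2) 2 =
       replicate_mset 2 1 + replicate_mset (t - 3 + e) 2 + replicate_mset c t"
      using t p by (simp add: multiset_eq_iff)
    ultimately show ?thesis by metis
  qed
qed


text \<open>\<open>1, \<dots>, r - 1\<close> can be traversed so that it ends at the largest vertex of the columns; the new vertices then bridge the gap to \<open>0\<close>, for either parity of \<open>r\<close>.\<close>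

lemma column_bridge:
  assumes "v0 = c + t" "t \<le> (v0 + e) div 2"
  shows "realizable (v0 + e) (replicate_mset (t - 1 + e) 1 + replicate_mset c t)"
proof -
  let ?v = "v0 + e"
  let ?f = "edge_len ?v"
  let ?js = "[1..<r]" and ?ks = "0 # rev [r..<t]"
  let ?A = "snake (even r) ?js" and ?X = "[v0..<?v]" and ?B = "snake True ?ks"
  have v: "2 \<le> ?v" using assms(2) t_pos by linarith
  have cov: "{..<t} \<subseteq> set (?js @ ?ks @ [])" by auto
  have len: "length (?js @ ?ks @ []) = t" using r_pos r_le by simp
  note z = snake3[OF cov len, where a = "even r" and b = True and c = True]
  have Jb: "links True ?ks = replicate_mset (t - r) 1"
  proof (cases "r = t")
    case False
    then have "r < t" using r_le by simp
    then have "links True ?ks = add_mset (gap (column_end True 0) (column_end True (t - 1))) (links False (rev [r..<t]))"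
      by (simp add: links_Cons hd_rev)
    moreover have "gap (column_end True 0) (column_end True (t - 1)) = 1"
      using gap_end_cross[of 0 "t - 1"] r_pos \<open>r < t\<close> by simp
    moreover have "links False (rev [r..<t]) = replicate_mset (t - r - 1) 1"
      by (subst links_high) (auto simp: steps_gap_upt)
    moreover have "t - r = Suc (t - r - 1)" using \<open>r < t\<close> by simp
    ultimately show ?thesis by (metis replicate_mset_Suc)
  next
    case True
    then have "[r..<t] = []" "t - r = 0" by simp_all
    then show ?thesis by (simp only: rev.simps links.simps replicate_mset_0)
  qed
  have Ja: "links (even r) ?js = replicate_mset (r - 2) 1"
    by (subst links_low) (auto simp: steps_gap_upt)
  have sumAB: "steps gap ?A + steps gap ?B = replicate_mset (r - 2 + (t - r)) 1 + replicate_mset c t"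
  proof -
    have "steps gap ?A + steps gap ?B = replicate_mset (r - 2) 1 + replicate_mset (t - r) 1 + replicate_mset c t"
      using z(3)[OF assms(1), unfolded Ja Jb] by (simp del: snake.simps(2))
    then show ?thesis by (simp add: multiset_eq_iff)
  qed
  have le: "x \<le> ?v div 2" if "x \<in># steps gap ?A + steps gap ?B" for x
  proof -
    have "x \<le> t" using that[unfolded sumAB] t_pos by (auto split: if_splits)
    then show ?thesis using assms(2) by simp
  qed
  have eq: "steps ?f ?A = steps gap ?A" "steps ?f ?B = steps gap ?B"
    by (rule steps_edge_len, rule le, simp del: snake.simps)+
  have X: "steps ?f ?X = replicate_mset (e - 1) 1"
  proof -
    have "steps ?f ?X = steps gap ?X"
      by (rule steps_edge_len) (use v in \<open>auto simp: steps_gap_upt split: if_splits\<close>)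
    then show ?thesis by (simp add: steps_gap_upt)
  qed
  have w: "?f (?v - 1) 0 = 1" "?f (v0 - 1) v0 = 1"
    using v r_pos by (simp_all add: edge_len_gap gap_def v0_def)
  have B: "?B \<noteq> []" "hd ?B = 0" by (simp_all add: column_end_def del: snake.simps)
  have A: "last ?A = v0 - 1" if "2 \<le> r"
    using that column_end_top[OF r_pos] r_pos by (simp add: last_upt)
  have "steps ?f (?A @ ?X @ ?B) = replicate_mset (t - 1 + e) 1 + replicate_mset c t"
  \<comment> \<open>For \<open>r = 1\<close> no column precedes the new vertices, so one link is
    absent.\<close>
  proof (cases "r = 1")
    case True
    then have "?js = []" "r - 2 + (t - r) = t - 1" by simp_all
    then have A0: "?A = []" "steps gap ?B = replicate_mset (t - 1) 1 + replicate_mset c t"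
      using sumAB by (simp_all only: snake.simps(1) steps.simps add_0)
    show ?thesis
    proof (cases "e = 0")
      case True
      then have "?X = []" by simp
      then have "steps ?f (?A @ ?X @ ?B) = steps ?f ?B" unfolding A0(1) by (simp only: append_Nil)
      also note eq(2)
      also note A0(2)
      finally show ?thesis using True by (simp only: add_0_right)
    next
      case False
      then have "steps ?f (?X @ ?B) = replicate_mset (e - 1) 1 + add_mset 1 (steps gap ?B)"
        using X eq(2) w B by (simp add: steps_append last_upt del: snake.simps)
      then show ?thesis using False t_pos unfolding A0 by (simp add: multiset_eq_iff del: snake.simps)
    qed
  next
    case False
    then have r: "2 \<le> r" using r_pos by simp
    then have ne: "?A \<noteq> []" by simp
    have "steps ?f (?A @ ?X @ ?B) = steps gap ?A + replicate_mset (Suc e) 1 + steps gap ?B"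
    proof (cases "e = 0")
      case True
      then show ?thesis using ne B A[OF r] eq w by (simp add: steps_append multiset_eq_iff del: snake.simps)
    next
      case False
      then have "?X \<noteq> []" "hd ?X = v0" "last ?X = ?v - 1" by (simp_all add: last_upt)
      then have "steps ?f (?A @ ?X @ ?B) = steps ?f ?A + add_mset 1 (steps ?f ?X + add_mset 1 (steps ?f ?B))"
        using ne B A[OF r] w by (simp add: steps_append del: snake.simps)
      then show ?thesis using eq X False by (simp add: multiset_eq_iff del: snake.simps)
    qed
    also have "\<dots> = (steps gap ?A + steps gap ?B) + replicate_mset (Suc e) 1" by (simp add: multiset_eq_iff del: snake.simps)
    also have "\<dots> = replicate_mset (t - 1 + e) 1 + replicate_mset c t"
      unfolding sumAB using r r_le by (simp add: multiset_eq_iff)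
    finally show ?thesis .
  qed
  moreover have "set (?A @ ?X @ ?B) = set (?A @ ?B @ snake True []) \<union> {v0..<?v}" by (auto simp del: snake.simps(2))
  then have "set (?A @ ?X @ ?B) = {0..<v0} \<union> {v0..<?v}" unfolding z(1) .
  then have "set (?A @ ?X @ ?B) = {0..<?v}" using ivl_disj_un_two(3)[of 0 v0 ?v] by simp
  moreover have "length (?A @ ?X @ ?B) = ?v" using z(2) by (simp del: snake.simps(2))
  ultimately show ?thesis by (intro realizable_steps)
qed

end

section \<open>Lists with two lengths, and doubling\<close>

lemma realizable_two_steps:
  assumes "1 \<le> s" "s \<le> x + 1" "2 * s \<le> x + y + 1"
  shows "realizable (x + y + 1) (replicate_mset x 1 + replicate_mset y s)"
proof (cases "y = 0")
  case True
  \<comment> \<open>With no edge of length \<open>s\<close>, every column is a single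
    vertex.\<close>
  then interpret columns s 0 s by unfold_locales (use assms in auto)
  have "v0 = 0 + s" by (simp add: v0_def)
  from column_bridge[OF this, of "x + 1 - s"] assms True show ?thesis by (simp add: v0_def)
next
  case False
  \<comment> \<open>The shift by 1 gives \<open>y + s = q * s + r\<close> with \<open>r\<close>
    between 1 and \<open>s\<close>.\<close>
  define q r where "q = (y - 1) div s + 1" and "r = (y - 1) mod s + 1"
  have "r \<le> s" using mod_less_divisor[of s "y - 1"] assms(1) unfolding r_def by linarith
  then interpret columns s q r
    by unfold_locales (simp_all add: q_def r_def)
  have dist: "((y - 1) div s + 1) * s = (y - 1) div s * s + s" by (simp add: add_mult_distrib)
  have v: "v0 = y + s"
    using div_mult_mod_eq[of "y - 1" s] False unfolding v0_def unfolding q_def r_def dist by linarith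
  have "v0 + (x + 1 - s) = x + y + 1" "s - 1 + (x + 1 - s) = x" using v assms by simp_all
  then show ?thesis using column_bridge[OF v, of "x + 1 - s"] assms by simp
qed

lemma edge_len_double: "edge_len (2 * n) (2 * x + k) (2 * y + k) = 2 * edge_len n x y"
proof -
  have "gap (2 * x) (2 * y) = 2 * gap x y" by (simp add: gap_def diff_mult_distrib2 add_mult_distrib2)
  moreover have "min (2 * d) (2 * n - 2 * d) = 2 * min d (n - d)" for d :: nat by linarith
  ultimately show ?thesis by (simp add: edge_len_gap)
qed

lemma rotate_path:
  assumes "ham_path n Q" "path_lengths n Q = L" "Q \<noteq> []" "l < n"
  shows "\<exists>R. ham_path n R \<and> path_lengths n R = L \<and> R \<noteq> [] \<and> hd R = l"
proof -
  have hd_less: "hd Q < n" using assms(1) hd_in_set[OF assms(3)] by (auto simp: ham_path_def)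
  define d where "d = (if hd Q \<le> l then l - hd Q else l + n - hd Q)"
  have d: "d < n" using hd_less assms(4) by (auto simp: d_def)
  define g where "g = (\<lambda>x. if x + d < n then x + d else x + d - n)"
  have inj: "inj_on g {0..<n}" using d by (auto simp: inj_on_def g_def)
  have sub: "g ` {0..<n} \<subseteq> {0..<n}" using d by (auto simp: g_def)
  have img: "g ` {0..<n} = {0..<n}"
    using card_image[OF inj] by (intro card_subset_eq sub) auto
  have "steps (edge_len n) (map g Q) = steps (edge_len n) Q"
    unfolding steps_map
  proof (rule steps_cong_on)
    fix x y assume "x \<in> set Q" "y \<in> set Q"
    then have "x < n" "y < n" using assms(1) by (auto simp: ham_path_def)
    then show "edge_len n (g x) (g y) = edge_len n x y"
      using d unfolding g_def edge_len_gap gap_def by (auto simp: min_def)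
  qed
  moreover have "ham_path n (map g Q)"
    using assms(1) inj img by (simp add: ham_path_def distinct_map)
  moreover have "hd (map g Q) = l"
    using assms(3,4) hd_less by (auto simp: hd_map g_def d_def)
  ultimately show ?thesis using assms(2,3) by (intro exI[of _ "map g Q"]) (simp add: path_lengths_steps)
qed

text \<open>Doubling a cycle doubles its lengths. One path runs on the even vertices, the other on
  the odd ones, rotated to start where the first ends; the edge from \<open>2 * l\<close> to
  \<open>2 * l + 1\<close> joins them.\<close>

lemma realizable_double:
  assumes "realizable n K" "realizable n L" "1 \<le> n"
  shows "realizable (2 * n) (add_mset 1 (image_mset ((*) 2) (K + L)))"
proof -
  obtain P where P: "ham_path n P" "path_lengths n P = K" using assms(1) by (auto simp: realizable_def)
  obtain Q where Q: "ham_path n Q" "path_lengths n Q = L" using assms(2) by (auto simp: realizable_def)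
  have ne: "P \<noteq> []" "Q \<noteq> []" using P(1) Q(1) assms(3) by (auto simp: ham_path_def)
  have "last P < n" using P(1) last_in_set[OF ne(1)] by (auto simp: ham_path_def)
  from rotate_path[OF Q ne(2) this] obtain R where
    R: "ham_path n R" "path_lengths n R = L" "R \<noteq> []" "hd R = last P" by blast
  have im: "steps (\<lambda>x y. 2 * f x y) xs = image_mset ((*) 2) (steps f xs)" for f xs
    by (induction f xs rule: steps.induct) auto
  let ?P = "map ((*) 2) P" and ?R = "map (\<lambda>x. 2 * x + 1) R"
  have "edge_len (2 * n) (2 * last P) (2 * last P + 1) = 1"
    using assms(3) by (simp add: edge_len_gap gap_def)
  then have "steps (edge_len (2 * n)) (?P @ ?R) = add_mset 1 (image_mset ((*) 2) (K + L))"
    using ne R P(2)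
    by (simp add: steps_append steps_map edge_len_double edge_len_double[of _ _ 0, simplified] im path_lengths_steps last_map hd_map)
  moreover have "set (?P @ ?R) = {0..<2 * n}"
  proof -
    have "(*) 2 ` {0..<n} \<union> (\<lambda>x. 2 * x + 1) ` {0..<n} = {0..<2 * n}"
    proof (intro equalityI subsetI)
      fix x assume x: "x \<in> {0..<2 * n}"
      show "x \<in> (*) 2 ` {0..<n} \<union> (\<lambda>x. 2 * x + 1) ` {0..<n}"
      proof (cases "even x")
        case True
        then obtain y where "x = 2 * y" by (elim evenE)
        then show ?thesis using x by simp
      next
        case False
        then obtain y where "x = 2 * y + 1" by (elim oddE)
        then show ?thesis using x by simp
      qed
    qed auto
    then show ?thesis using P(1) R(1) by (simp add: ham_path_def)
  qed
  moreover have "length P = n" "length R = n"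
    using P(1) R(1) distinct_card[of P] distinct_card[of R] by (auto simp: ham_path_def)
  then have "length (?P @ ?R) = 2 * n" by simp
  ultimately show ?thesis by (intro realizable_steps)
qed

section \<open>Case distinction on \<open>a\<close> and \<open>r\<close>\<close>

lemma L_list_realizable:
  assumes "even t" "4 \<le> t" "1 \<le> a" "1 \<le> b" "1 \<le> c" "t \<le> a + b + 1"
    and v: "v = a + b + c + 1" and le: "t \<le> v div 2"
  shows "realizable v (L_list a b t c)"
proof -
  have linear_real: "realizable v (L_list a b t c)" if "linear n P L" "n = v" "L = L_list a b t c" for n P L
    by (rule linear_realizable[of _ P]) (use that assms(2) le in \<open>auto simp: L_list_def split: if_splits\<close>)
  define q r where "q = (c - 1) div t + 1" and "r = (c - 1) mod t + 1"
  have "r \<le> t" using mod_less_divisor[of t "c - 1"] assms(2) unfolding r_def by linarith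
  then interpret columns t q r
    by unfold_locales (simp_all add: q_def r_def)
  have dist: "((c - 1) div t + 1) * t = (c - 1) div t * t + t" by (simp add: add_mult_distrib)
  have v0: "v0 = c + t"
    using div_mult_mod_eq[of "c - 1" t] assms(5) unfolding v0_def unfolding q_def r_def dist by linarith
  define e where "e = a + b + 1 - t"
  have ve: "v = v0 + e" "t \<le> (v0 + e) div 2" using v v0 assms(6) le by (simp_all add: e_def)
  have be: "e + t = a + b + 1" using assms(6) by (simp add: e_def)
  have v2: "2 \<le> v0" using v0 assms(2) by simp
  \<comment> \<open>All edges beyond those of the columns have length 2 and are inserted between
    neighbouring extreme vertices.\<close>
  have swap: "realizable v (L_list a b t c)"
    if "\<exists>P. linear v0 P (replicate_mset a 1 + replicate_mset b' 2 + replicate_mset c t) \<and> (adjacent P (v0 - 2) (v0 - 1) \<or> adjacent P 0 1)"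
      "a + b' + 1 = t" for b'
  proof -
    from that obtain P where "linear v0 P (replicate_mset a 1 + replicate_mset b' 2 + replicate_mset c t)"
      "adjacent P (v0 - 2) (v0 - 1) \<or> adjacent P 0 1" by blast
    from linear_insert_adjacent[OF this v2, of e] obtain P' where
      P': "linear (v0 + e) P' (replicate_mset a 1 + replicate_mset b' 2 + replicate_mset c t + replicate_mset e 2)"
      by blast
    show ?thesis
      by (rule linear_real[OF P']) (use ve be that(2) in \<open>auto simp: L_list_def multiset_eq_iff\<close>)
  qed
  \<comment> \<open>Some edges of length 1 are left for the end 0; \<open>a' < a\<close> guarantees
    at least one.\<close>
  have extend: "realizable v (L_list a b t c)"
    if "\<exists>P. linear v0 P (replicate_mset a' 1 + replicate_mset b' 2 + replicate_mset c t) \<and> P \<noteq> [] \<and> hd P = 0"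
      "a' + b' + 1 = t" "a' < a" "b' \<le> b" for a' b'
  proof -
    from that obtain P where "linear v0 P (replicate_mset a' 1 + replicate_mset b' 2 + replicate_mset c t)"
      "P \<noteq> []" "hd P = 0" by blast
    from linear_extend[OF this, of "a - a'" "b - b'"] that(3) obtain P' where
      P': "linear (v0 + (a - a') + (b - b')) P' (replicate_mset a' 1 + replicate_mset b' 2 + replicate_mset c t +
         replicate_mset (a - a') 1 + replicate_mset (b - b') 2)"
      by auto
    show ?thesis
      by (rule linear_real[OF P']) (use ve be that(2-4) in \<open>auto simp: L_list_def multiset_eq_iff\<close>)
  qed
  have one: "add_mset 1 M = replicate_mset 1 1 + M" for M :: "nat multiset" by (simp add: One_nat_def)
  have r_odd: "r mod 4 = 1 \<or> r mod 4 = 3" if "odd r" using that by presburger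
  have r_mod_1: "r + 3 \<le> t \<or> t mod 4 = 2 \<and> r = t - 1" if "r mod 4 = 1"
  proof (cases "r + 3 \<le> t")
    case False
    have "r \<noteq> t" "r + 2 \<noteq> t" using that assms(1) by presburger+
    then have "t = r + 1" using False \<open>r \<le> t\<close> by linarith
    then show ?thesis using that by presburger
  qed simp
  consider "t \<le> a" | "3 \<le> a" "a < t" | "a = 2" | "a = 1" using assms(3) by linarith
  then show ?thesis
  proof cases
    case 1
    have "\<exists>P. linear v0 P (replicate_mset (t - 1) 1 + replicate_mset 0 2 + replicate_mset c t) \<and> P \<noteq> [] \<and> hd P = 0"
      using ones_realization[OF assms(1) v0] by simp
    then show ?thesis by (rule extend) (use 1 assms(2) in auto)
  next
    case 2
    define b' where "b' = t - 1 - a"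
    have b': "a + b' + 1 = t" using 2 by (simp add: b'_def)
    show ?thesis
    proof (cases "r < a")
      case True
      from hook_realization[OF _ b' True v0] 2 show ?thesis by (intro swap[OF _ b']) auto
    next
      case False
      from double_hook_realization[OF _ b' _ v0 assms(2)] 2 False show ?thesis by (intro swap[OF _ b']) auto
    qed
  next
    case 3
    have b': "a + (t - 3) + 1 = t" using 3 assms(2) by simp
    have "r = 2 \<or> 4 \<le> r" if "even r" using that r_pos by presburger
    moreover have "r = 1 \<or> 3 \<le> r" if "odd r" using that by presburger
    moreover have "r = t \<or> r < t" using r_le by linarith
    moreover have "e = 0 \<or> 0 < e" "r = 1 \<or> 2 \<le> r" using r_pos by linarith+
    ultimately consider "r = 1" | "r = 2 \<or> r = t" | "even r" "4 \<le> r" "r < t" | "e = 0" "2 \<le> r" | "0 < e" "odd r" "3 \<le> r" "r < t"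
      by blast
    then show ?thesis
    proof cases
      case 1
      from hook_realization[OF _ b' _ v0] 1 3 show ?thesis by (intro swap[OF _ b']) auto
    next
      case 2
      from double_hook_realization[OF _ b' _ v0 assms(2)] 2 3 assms(2) show ?thesis by (intro swap[OF _ b']) auto
    next
      case r: 3
      from strands_r_even(2)[OF assms(1) r(1,2) v0 ve(2) r(3)] show ?thesis
        unfolding ve(1) using be b' 3 by (simp add: L_list_def add.commute)
    next
      \<comment> \<open>Nothing is inserted, so no neighbouring extreme vertices are
        required.\<close>
      case r: 4
      from double_hook_realization[OF _ b' _ v0 assms(2)] r 3 obtain P where
        P: "linear v0 P (replicate_mset a 1 + replicate_mset (t - 3) 2 + replicate_mset c t)" by auto
      show ?thesis by (rule linear_real[OF P]) (use ve r be b' in \<open>auto simp: L_list_def\<close>)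
    next
      case r: 5
      consider "r mod 4 = 3" | "r mod 4 = 1" "r + 3 \<le> t" | "t mod 4 = 2" "r = t - 1"
        using r_odd r_mod_1 r(2) by blast
      then show ?thesis
      proof cases
        \<comment> \<open>Since \<open>0 < e\<close>, the list contains the \<open>t - 2\<close>
          edges of length 2 used by this path.\<close>
        case 1
        from hook_at_zero[OF assms(1) 1 v0] show ?thesis
          unfolding one by (rule extend) (use 3 r be assms(2) in auto)
      next
        case 2
        from two_ones_r_mod_4_eq_1[OF assms(1) 2(1) _ 2(2) v0] r 3 show ?thesis
          by (intro swap[OF _ b']) auto
      next
        case 3
        from single_one_r_last[OF 3(1) assms(2) 3(2) v0]
        have "\<exists>P. linear v0 P (replicate_mset 1 1 + replicate_mset (t - 2) 2 + replicate_mset c t) \<and> P \<noteq> [] \<and> hd P = 0"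
          unfolding one by blast
        then show ?thesis by (rule extend) (use \<open>a = 2\<close> r be assms(2) in auto)
      qed
    qed
  next
    case 4
    have b': "a + (t - 2) + 1 = t" using 4 assms(2) by simp
    have real: "realizable v (L_list a b t c)"
      if "realizable (v0 + e) (add_mset 1 (replicate_mset (t - 2 + e) 2) + replicate_mset c t)"
    proof -
      have "t - 2 + e = b" using be 4 assms(2) by simp
      then show ?thesis using that ve(1) 4 by (simp add: L_list_def One_nat_def)
    qed
    have seed: "realizable v (L_list a b t c)"
      if "\<exists>P. linear v0 P (add_mset 1 (replicate_mset (t - 2) 2) + replicate_mset c t) \<and>
        (adjacent P (v0 - 2) (v0 - 1) \<or> adjacent P 0 1)"
      by (rule swap[OF _ b']) (use that 4 in \<open>simp add: One_nat_def\<close>)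
    show ?thesis
    proof (cases "even v")
      case True
      define s where "s = t div 2"
      have s: "t = 2 * s" "2 \<le> s" using assms(1,2) by (auto simp: s_def)
      define n where "n = v div 2"
      have n: "v = 2 * n" using True by (simp add: n_def)
      \<comment> \<open>An even split of \<open>b \<ge> t - 2\<close> leaves at least
        \<open>s - 1\<close> edges for each parity class; edges of length \<open>t\<close> fill each
        class up to \<open>n - 1\<close>.\<close>
      define x1 x2 y1 y2 where "x1 = b div 2" and "x2 = b - x1" and "y1 = n - 1 - x1" and "y2 = n - 1 - x2"
      have "2 * n = b + c + 2" using v n 4 by simp
      then have x: "x1 + y1 + 1 = n" "x2 + y2 + 1 = n" "x1 + x2 = b" "y1 + y2 = c" "s \<le> x1 + 1" "s \<le> x2 + 1" "2 * s \<le> n"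
        using assms(5,6) le s n 4 by (auto simp: x1_def x2_def y1_def y2_def)
      have "realizable (2 * n) (add_mset 1 (image_mset ((*) 2)
         ((replicate_mset x1 1 + replicate_mset y1 s) + (replicate_mset x2 1 + replicate_mset y2 s))))"
        by (rule realizable_double)
          (use realizable_two_steps[of s x1 y1] realizable_two_steps[of s x2 y2] x s in auto)
      also have "add_mset 1 (image_mset ((*) 2)
         ((replicate_mset x1 1 + replicate_mset y1 s) + (replicate_mset x2 1 + replicate_mset y2 s))) = L_list a b t c"
        using s 4 unfolding x(3,4)[symmetric] by (auto simp: L_list_def multiset_eq_iff)
      finally show ?thesis using n by simp
    next
      case False
      then have par: "odd v" .
      \<comment> \<open>As \<open>v = q * t + r + e\<close> is odd and \<open>t\<close> even,
        \<open>r + e\<close> is odd. For odd \<open>r\<close> the new vertices thus split into two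
        strands of equal size.\<close>
      have par_e: "even e \<longleftrightarrow> odd r" using par assms(1) ve(1) by (simp add: v0_def)
      have "r = 2 \<or> 4 \<le> r" if "even r" using that r_pos by presburger
      moreover have "4 dvd t \<or> t mod 4 = 2" using assms(1) by presburger
      ultimately consider "r = 1" | "r = 2" | "even r" "4 \<le> r" | "r = 3" | "r mod 4 = 3" "r \<noteq> 3" "4 dvd t"
        | "r mod 4 = 3" "r \<noteq> 3" "t mod 4 = 2" | "t mod 4 = 2" "r = t - 1" | "r mod 4 = 1" "r \<noteq> 1" "r + 3 \<le> t"
        using r_odd r_mod_1 by blast
      then show ?thesis
      proof cases
        case 1
        from single_one_r_1[OF assms(1,2) 1 v0] show ?thesis by (intro seed) blast
      next
        case 2
        from single_one_r_2[OF assms(1,2) 2 v0] show ?thesis by (intro seed) blast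
      next
        case 3
        from strands_r_even(1)[OF assms(1) 3 v0 ve(2)] show ?thesis by (rule real)
      next
        case r: 4
        from single_one_r_3[OF assms(1,2) r v0] show ?thesis by (intro seed) blast
      next
        case 5
        from single_one_r_mod_4_eq_3[OF 5(3,1,2) v0] show ?thesis by (intro seed) blast
      next
        case 6
        then have "odd r" by presburger
        then obtain i where "e = 2 * i" using par_e by (elim iffD2[THEN evenE])
        with strands_r_mod_4_eq_3[OF 6(3,1,2) v0] ve(2) show ?thesis by (intro real) simp
      next
        case 7
        from single_one_r_last[OF 7(1) assms(2) 7(2) v0] show ?thesis by (intro seed) blast
      next
        case 8
        then have "odd r" by presburger
        then obtain i where "e = 2 * i" using par_e by (elim iffD2[THEN evenE])
        with strands_r_mod_4_eq_1[OF assms(1) 8 v0] ve(2) show ?thesis by (intro real) simp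
      qed
    qed
  qed
qed

text \<open>For \<open>d = 1\<close> the bound is an equality, and for \<open>d = 2\<close> the
  count \<open>b + c\<close> is small enough because \<open>1 \<le> a\<close>.\<close>

lemma divisor_condition:
  assumes "even t" "4 \<le> t" "1 \<le> a" "t \<le> a + b + 1" "d dvd a + b + c + 1" "1 \<le> d"
  shows "size (filter_mset (\<lambda>x. d dvd x) (L_list a b t c)) \<le> a + b + c + 1 - d"
proof -
  have size: "size (filter_mset (\<lambda>x. d dvd x) (L_list a b t c)) =
      (if d dvd 1 then a else 0) + (if d dvd 2 then b else 0) + (if d dvd t then c else 0)"
  proof -
    have "size (filter_mset P (replicate_mset n x)) = (if P x then n else 0)" for P n and x :: nat
      by (induction n) auto
    then show ?thesis by (simp add: L_list_def)
  qed
  have "d \<le> t" if "d dvd t" using that assms(2) by (intro dvd_imp_le) auto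
  moreover have "d \<le> a + b + c + 1" using assms(5) by (intro dvd_imp_le) auto
  moreover have "d = 1 \<or> d = 2" if "d dvd 2" using dvd_imp_le[OF that] assms(6) by linarith
  moreover have "d dvd 1 \<longleftrightarrow> d = 1" by simp
  ultimately show ?thesis unfolding size using assms(3,4) by (auto split: if_splits)
qed

theorem theorem1p5:
  fixes t a b c v :: nat
  assumes "even t" and "t \<ge> 4"
    and "a \<ge> 1" and "b \<ge> 1" and "c \<ge> 1"
    and "a + b \<ge> t - 1"
    and "v = a + b + c + 1"
    and "t \<le> v div 2"
  shows "(\<exists>P. ham_path v P \<and> path_lengths v P = L_list a b t c) \<longleftrightarrow>
         (\<forall>d. d dvd v \<and> d \<ge> 1 \<longrightarrow> size (filter_mset (\<lambda>x. d dvd x) (L_list a b t c)) \<le> v - d)"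
proof -
  have t: "t \<le> a + b + 1" using assms(6) by simp
  have "\<exists>P. ham_path v P \<and> path_lengths v P = L_list a b t c"
    using L_list_realizable[OF assms(1-5) t assms(7,8)] by (simp add: realizable_def)
  moreover have "\<forall>d. d dvd v \<and> d \<ge> 1 \<longrightarrow> size (filter_mset (\<lambda>x. d dvd x) (L_list a b t c)) \<le> v - d"
    using divisor_condition[OF assms(1-3) t] unfolding assms(7) by blast
  ultimately show ?thesis by blast
qed

end
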